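(* If $\mathfrak c\le\aleph_2$, then there is a separable $0$-dimensional (Hausdorff) pseudoradial space of cardinality greater than $\mathfrak c$.
   Context: Here $\mathfrak c=2^{\aleph_0}$. All spaces are regular Hausdorff. A space is $0$-dimensional if it has a base consisting of clopen sets. For an infinite cardinal $\kappa$, a sequence $\{x_\alpha:\alpha<\kappa\}$ converges to $x$ in a space $X$ if for every neighborhood $U$ of $x$ there is $\beta<\kappa$ such that $\{x_\alpha:\beta<\alpha<\kappa\}\subset U$. A set $A\subset X$ is radially closed in $X$ if, for every infinite cardinal $\kappa\le |X|$, no $\kappa$-sequence of points of $A$ converges to a point not in $A$. A space $X$ is pseudoradial if every radially closed subset of $X$ is closed. *)

theory Defs
  imports "HOL-Analysis.Analysis"
begin

unbundle cardinal_syntax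

definition zero_dimensional_space :: "'a topology \<Rightarrow> bool" where
  "zero_dimensional_space X \<longleftrightarrow>
     (\<exists>\<B>. (\<forall>V\<in>\<B>. openin X V \<and> closedin X V) \<and>
          (\<forall>U x. openin X U \<and> x \<in> U \<longrightarrow> (\<exists>V\<in>\<B>. x \<in> V \<and> V \<subseteq> U)))"

(* A cardinal kappa is represented by a relation r with Card_order r, and a kappa-sequence by
   the restriction of a function to Field r. Since r is reflexive, (b, a) : r together with
   a ~= b says that the index b lies strictly below a. *)
definition seq_converges :: "'k rel \<Rightarrow> 'a topology \<Rightarrow> ('k \<Rightarrow> 'a) \<Rightarrow> 'a \<Rightarrow> bool" where
  "seq_converges r X f x \<longleftrightarrow>
     x \<in> topspace X \<and>
     (\<forall>U. openin X U \<and> x \<in> U \<longrightarrow>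
       (\<exists>b\<in>Field r. \<forall>a\<in>Field r. (b, a) \<in> r \<and> a \<noteq> b \<longrightarrow> f a \<in> U))"

(* Every cardinal that is at most the cardinality of the space is order isomorphic to a cardinal
   order on a subset of the space, so letting r range over relations on 'a loses no cardinal. *)
definition radially_closedin :: "'a topology \<Rightarrow> 'a set \<Rightarrow> bool" where
  "radially_closedin X A \<longleftrightarrow>
     A \<subseteq> topspace X \<and>
     (\<forall>(r :: 'a rel) f x.
        Cinfinite r \<and> r \<le>o |topspace X| \<and> f ` Field r \<subseteq> A \<and> seq_converges r X f x \<longrightarrow> x \<in> A)"

definition pseudoradial_space :: "'a topology \<Rightarrow> bool" where
  "pseudoradial_space X \<longleftrightarrow> (\<forall>A. radially_closedin X A \<longrightarrow> closedin X A)"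

(* 2 to the power aleph_0 *)
abbreviation continuum where
  "continuum \<equiv> ctwo ^c natLeq"

abbreviation aleph_2 where
  "aleph_2 \<equiv> cardSuc (cardSuc natLeq)"

end

theory Submission
  imports Defs "HOL-Library.Countable_Set_Type"
begin

text \<open>
  Let \<open>\<kappa>\<close> be \<open>\<aleph>\<^sub>1\<close> if \<open>2 ^ \<aleph>\<^sub>1\<close> exceeds the continuum, and
  \<open>\<aleph>\<^sub>2\<close> otherwise. If the continuum is at most \<open>\<aleph>\<^sub>2\<close>, then \<open>2 ^ \<kappa>\<close>
  exceeds the continuum, while the full binary tree of height \<open>\<kappa>\<close> has at most continuum
  many nodes, so that its nodes can be coded by sets of natural numbers, elements of the Cantor
  set. Consider the following sets of nodes, with the pointwise topology: all countable sets,
  and all paths, that is, the initial segments of branches, including the more than continuum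
  many full branches.

  This space of points is pseudoradial (\<open>adherent_imp_mem\<close>). Let \<open>C\<close> be closed
  under limits of sequences indexed by cardinals, and let \<open>Y\<close> be adherent to it.

  \<^item> If \<open>Y\<close> is adherent to the countable members of \<open>C\<close>, then every countable
    subset of \<open>Y\<close> is contained in a countable subset of \<open>Y\<close> that belongs to \<open>C\<close>
    (\<open>adherent_countable_subset\<close>). This settles countable \<open>Y\<close>, and exhibits a path of
    size \<open>\<aleph>\<^sub>1\<close> as the limit of an \<open>\<aleph>\<^sub>1\<close>-sequence from \<open>C\<close>. A full path of
    length \<open>\<aleph>\<^sub>2\<close> is the limit of those of its initial segments that belong to
    \<open>C\<close>, and these are cofinal by a closing-off argument (\<open>full_path_mem\<close>).
  \<^item> If \<open>Y\<close> is adherent to the paths in \<open>C\<close>, then \<open>Y\<close> is itself a path, and paths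
    in \<open>C\<close> that follow \<open>Y\<close> longer and longer converge to it
    (\<open>path_limit_mem\<close>).

  It remains to add a countable dense set of isolated elements. The finite sets of nodes are
  dense among the points, and each of them is the pointwise limit of a sequence of clopen subsets
  of the Cantor set, of which there are only countably many. Take these clopen sets as isolated
  elements, and refine the pointwise topology by declaring closed every set of isolated
  elements that is almost disjoint from each of these sequences. The sequences still converge,
  so the isolated elements stay dense; and if a radially closed set contains no point of some
  basic neighbourhood, then its isolated elements there form a closed set, which can be
  removed from that neighbourhood.
\<close>

section \<open>Cardinality and closing off\<close>

lemma card_of_Fpow_bound:
  assumes s: "Cinfinite s" and A: "|A| \<le>o s"
  shows "|Fpow A| \<le>o s"
proof -
  have inf: "\<not> finite (Field s)" and co: "Card_order s"
    using s by (auto simp: cinfinite_def)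
  \<comment> \<open>the finite subsets, sorted by their number of elements\<close>
  define S where "S n = {H. H \<subseteq> A \<and> finite H \<and> card H = n}" for n :: nat
  have "|S n| \<le>o s" for n
  proof (induction n)
    case 0
    have "S 0 \<subseteq> {{}}" by (auto simp: S_def)
    then have "|S 0| <o s"
      using finite_ordLess_infinite[OF card_of_Well_order[of "S 0"] card_order_on_well_order_on[OF co] _ inf]
      by (simp add: Field_card_of finite_subset)
    then show ?case by (rule ordLess_imp_ordLeq)
  next
    case (Suc n)
    have "S (Suc n) \<subseteq> (\<lambda>(a, H). insert a H) ` (A \<times> S n)"
    proof
      fix H assume H: "H \<in> S (Suc n)"
      then obtain a where a: "a \<in> H" by (force simp: S_def)
      have "H - {a} \<in> S n" using H a by (auto simp: S_def)
      moreover have "H = insert a (H - {a})" "a \<in> A" using a H by (auto simp: S_def)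
      ultimately show "H \<in> (\<lambda>(a, H). insert a H) ` (A \<times> S n)"
        by (intro image_eqI[of _ _ "(a, H - {a})"]) simp_all
    qed
    then have "|S (Suc n)| \<le>o |(\<lambda>(a, H). insert a H) ` (A \<times> S n)|" by (rule card_of_mono1)
    also have "|(\<lambda>(a, H). insert a H) ` (A \<times> S n)| \<le>o |A \<times> S n|" by (rule card_of_image)
    also have "|A \<times> S n| \<le>o s"
      using card_of_Times_ordLeq_infinite_Field[OF inf A Suc co] .
    finally show ?case .
  qed
  moreover have "|UNIV :: nat set| \<le>o s"
    using natLeq_ordLeq_cinfinite[OF s] card_of_nat ordIso_ordLeq_trans by blast
  ultimately have "|\<Union>n\<in>UNIV. S n| \<le>o s"
    using UNION_Cinfinite_bound[OF _ _ s] by blast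
  moreover have "Fpow A \<subseteq> (\<Union>n\<in>UNIV. S n)" by (auto simp: Fpow_def S_def)
  ultimately show ?thesis using card_of_mono1 ordLeq_transitive by blast
qed

text \<open>
  A set can be closed off under a set-valued operation on its finite subsets without
  exceeding an infinite cardinal that bounds the set and all values of the operation.
\<close>

lemma closing_off:
  assumes s: "Cinfinite s" and A: "|A| \<le>o s" and \<phi>: "\<And>H. finite H \<Longrightarrow> |\<phi> H| \<le>o s"
  obtains L where "A \<subseteq> L" "|L| \<le>o s" "\<And>H. finite H \<Longrightarrow> H \<subseteq> L \<Longrightarrow> \<phi> H \<subseteq> L"
proof -
  define step where "step S = S \<union> (\<Union>H\<in>Fpow S. \<phi> H)" for S
  define L where "L n = (step ^^ n) A" for n
  have L_Suc: "L (Suc n) = step (L n)" for n by (simp add: L_def)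
  have bound: "|L n| \<le>o s" for n
  proof (induction n)
    case (Suc n)
    have "|\<Union>H\<in>Fpow (L n). \<phi> H| \<le>o s"
      by (rule UNION_Cinfinite_bound[OF card_of_Fpow_bound[OF s Suc] _ s])
         (auto simp: Fpow_def \<phi>)
    then show ?case unfolding L_Suc step_def by (rule Un_Cinfinite_bound[OF Suc _ s])
  qed (simp add: L_def A)
  have "mono L" by (rule mono_iff_le_Suc[THEN iffD2]) (auto simp: L_Suc step_def)
  have fin: "\<exists>n. H \<subseteq> L n" if "finite H" "H \<subseteq> (\<Union>n. L n)" for H
    using that
  proof (induction rule: finite_induct)
    case (insert h H)
    then obtain m n where "h \<in> L m" "H \<subseteq> L n" by auto
    then have "insert h H \<subseteq> L (max m n)"
      using monoD[OF \<open>mono L\<close>, of m "max m n"] monoD[OF \<open>mono L\<close>, of n "max m n"] by auto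
    then show ?case by blast
  qed auto
  have "|UNIV :: nat set| \<le>o s"
    using natLeq_ordLeq_cinfinite[OF s] card_of_nat ordIso_ordLeq_trans by blast
  then have "|\<Union>n. L n| \<le>o s" by (rule UNION_Cinfinite_bound) (auto simp: bound s)
  moreover have "A \<subseteq> (\<Union>n. L n)" using L_def[of 0] by auto
  moreover have "\<phi> H \<subseteq> (\<Union>n. L n)" if H: "finite H" "H \<subseteq> (\<Union>n. L n)" for H
  proof -
    obtain n where "H \<subseteq> L n" using fin[OF H] by blast
    then have "\<phi> H \<subseteq> L (Suc n)" using H(1) by (auto simp: L_Suc step_def Fpow_def)
    then show ?thesis by blast
  qed
  ultimately show ?thesis using that by blast
qed

section \<open>Transfinite sequences of sets and pointwise convergence\<close>

text \<open>
  A property holds eventually along \<open>s\<close> if it holds at all indices that lie strictly above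
  some index.
\<close>

definition eventually_along :: "'k rel \<Rightarrow> ('k \<Rightarrow> bool) \<Rightarrow> bool" where
  "eventually_along s P \<longleftrightarrow> (\<exists>b\<in>Field s. \<forall>a\<in>Field s. (b, a) \<in> s \<and> a \<noteq> b \<longrightarrow> P a)"

lemma eventually_along_mono:
  assumes "eventually_along s P" "\<And>a. \<lbrakk>a \<in> Field s; P a\<rbrakk> \<Longrightarrow> Q a"
  shows "eventually_along s Q"
proof -
  obtain b where "b \<in> Field s" "\<forall>a\<in>Field s. (b, a) \<in> s \<and> a \<noteq> b \<longrightarrow> P a"
    using assms(1) unfolding eventually_along_def by blast
  then show ?thesis using assms(2) unfolding eventually_along_def by (intro bexI[of _ b]) simp_all
qed

lemma eventually_along_above:
  assumes "b \<in> Field s" "\<And>a. \<lbrakk>a \<in> Field s; (b, a) \<in> s\<rbrakk> \<Longrightarrow> P a"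
  shows "eventually_along s P"
  unfolding eventually_along_def using assms by (intro bexI[of _ b]) simp_all

lemma eventually_along_conj:
  assumes s: "Well_order s" and P: "eventually_along s P" and Q: "eventually_along s Q"
  shows "eventually_along s (\<lambda>a. P a \<and> Q a)"
proof -
  interpret wo_rel s using s by (simp add: wo_rel_def)
  obtain b c where b: "b \<in> Field s" "\<And>a. \<lbrakk>a \<in> Field s; (b, a) \<in> s; a \<noteq> b\<rbrakk> \<Longrightarrow> P a"
    and c: "c \<in> Field s" "\<And>a. \<lbrakk>a \<in> Field s; (c, a) \<in> s; a \<noteq> c\<rbrakk> \<Longrightarrow> Q a"
    using P Q unfolding eventually_along_def by blast
  have cases: "(b, c) \<in> s \<or> (c, b) \<in> s" using TOTALS b(1) c(1) by blast
  have tr: "(x, y) \<in> s \<Longrightarrow> (y, z) \<in> s \<Longrightarrow> (x, z) \<in> s" for x y z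
    using TRANS by (meson transD)
  have an: "(x, y) \<in> s \<Longrightarrow> (y, x) \<in> s \<Longrightarrow> x = y" for x y
    using ANTISYM by (meson antisymD)
  show ?thesis
  proof (cases "(b, c) \<in> s")
    case True
    then have "P a \<and> Q a" if "a \<in> Field s" "(c, a) \<in> s" "a \<noteq> c" for a
      using b(2)[of a] c(2)[of a] that tr an by blast
    then show ?thesis unfolding eventually_along_def using c(1) by blast
  next
    case False
    then have "(c, b) \<in> s" using cases by blast
    then have "P a \<and> Q a" if "a \<in> Field s" "(b, a) \<in> s" "a \<noteq> b" for a
      using b(2)[of a] c(2)[of a] that tr an by blast
    then show ?thesis unfolding eventually_along_def using b(1) by blast
  qed
qed

lemma eventually_along_ball:
  assumes s: "Well_order s" "Field s \<noteq> {}" and H: "finite H"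
    and P: "\<And>t. t \<in> H \<Longrightarrow> eventually_along s (P t)"
  shows "eventually_along s (\<lambda>a. \<forall>t\<in>H. P t a)"
  using H P
proof (induction rule: finite_induct)
  case empty
  then show ?case using s(2) unfolding eventually_along_def by blast
next
  case (insert h H)
  then have "eventually_along s (\<lambda>a. P h a \<and> (\<forall>t\<in>H. P t a))"
    by (intro eventually_along_conj s(1)) auto
  then show ?case by (rule eventually_along_mono) auto
qed

lemma eventually_along_natLeq: "eventually_along natLeq P \<longleftrightarrow> eventually P sequentially"
proof
  assume "eventually_along natLeq P"
  then obtain b where "\<And>a. b \<le> a \<Longrightarrow> a \<noteq> b \<Longrightarrow> P a"
    unfolding eventually_along_def natLeq_def by (auto simp: Field_def)
  then have "\<forall>n\<ge>Suc b. P n" by (simp add: Suc_le_eq)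
  then show "eventually P sequentially" unfolding eventually_sequentially by blast
next
  assume "eventually P sequentially"
  then show "eventually_along natLeq P"
    unfolding eventually_sequentially eventually_along_def Field_natLeq by (auto simp: natLeq_def)
qed

text \<open>
  In a linear order without a last element, a cofinal set of least cardinality is enumerated
  by its initial ordinal in such a way that every proper initial part of the enumeration is
  bounded. So some infinite cardinal maps to the order with values tending to its end.
\<close>

lemma cofinal_cardinal_sequence:
  fixes le :: "'i \<Rightarrow> 'i \<Rightarrow> bool"
  assumes trans: "\<And>x y z. \<lbrakk>x \<in> J; y \<in> J; z \<in> J; le x y; le y z\<rbrakk> \<Longrightarrow> le x z"
    and total: "\<And>x y. \<lbrakk>x \<in> J; y \<in> J\<rbrakk> \<Longrightarrow> le x y \<or> le y x"
    and ne: "J \<noteq> {}"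
    and no_max: "\<And>x. x \<in> J \<Longrightarrow> \<exists>y\<in>J. \<not> le y x"
  obtains s :: "'i rel" and g where "Cinfinite s" "s \<le>o |J|" "g ` Field s \<subseteq> J"
    "\<And>b. b \<in> J \<Longrightarrow> eventually_along s (\<lambda>a. le b (g a))"
proof -
  define cofinal where "cofinal Q \<longleftrightarrow> Q \<subseteq> J \<and> (\<forall>b\<in>J. \<exists>q\<in>Q. le b q)" for Q
  have "cofinal J" using total unfolding cofinal_def by blast
  then have "\<exists>s\<in>{|Q| | Q. cofinal Q}. \<forall>s'\<in>{|Q| | Q. cofinal Q}. s \<le>o s'"
    by (intro exists_minim_Card_order) (auto simp: card_of_Card_order)
  then obtain Q where Q: "cofinal Q" and least: "\<And>Q'. cofinal Q' \<Longrightarrow> |Q| \<le>o |Q'|" by auto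
  have QJ: "Q \<subseteq> J" using Q by (simp add: cofinal_def)
  have Q_ne: "Q \<noteq> {}" using Q ne unfolding cofinal_def by blast
  have fin_bdd: "\<exists>m\<in>F. \<forall>x\<in>F. le x m" if "finite F" "F \<noteq> {}" "F \<subseteq> J" for F
    using that
  proof (induction rule: finite_ne_induct)
    case (singleton x)
    then show ?case using total by blast
  next
    case (insert x F)
    then obtain m where m: "m \<in> F" "\<forall>y\<in>F. le y m" by blast
    show ?case
    proof (cases "le x m")
      case True
      then show ?thesis using m by blast
    next
      case False
      then have "le m x" "le x x" using total m insert.prems by blast+
      then show ?thesis using m trans insert.prems
        by (smt (verit, ccfv_threshold) insert_iff insert_subset subsetD)
    qed
  qed
  have "infinite Q"
  proof
    assume "finite Q"
    then obtain m where "m \<in> Q" "\<forall>x\<in>Q. le x m" using fin_bdd[OF _ Q_ne QJ] by blast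
    then show False using Q no_max[of m] trans unfolding cofinal_def by (meson subsetD)
  qed
  then have cinf: "Cinfinite |Q|" by (auto simp: cinfinite_def Field_card_of card_of_card_order_on)
  define bounds where "bounds x g \<longleftrightarrow> g \<in> J \<and> (\<forall>y\<in>under |Q| x. le y g)" for x g
  \<comment> \<open>an unbounded initial part would be a cofinal set of smaller cardinality\<close>
  have "\<exists>g. bounds x g" if x: "x \<in> Q" for x
  proof (rule ccontr)
    assume no: "\<not> (\<exists>g. bounds x g)"
    have sub: "under |Q| x \<subseteq> Q" using under_Field[of "|Q|"] by (simp add: Field_card_of)
    have "cofinal (under |Q| x)"
      unfolding cofinal_def
    proof (intro conjI ballI)
      show "under |Q| x \<subseteq> J" using sub QJ by blast
      fix b assume b: "b \<in> J"
      then obtain y where "y \<in> under |Q| x" "\<not> le y b" using no unfolding bounds_def by blast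
      moreover have "y \<in> J" using \<open>y \<in> under |Q| x\<close> sub QJ by (meson subsetD)
      ultimately have "le b y" using total[OF b] by blast
      then show "\<exists>q\<in>under |Q| x. le b q" using \<open>y \<in> under |Q| x\<close> by blast
    qed
    then have le: "|Q| \<le>o |under |Q| x|" by (rule least)
    obtain y where y: "y \<in> Q" "x \<noteq> y" "(x, y) \<in> |Q|"
      using infinite_Card_order_limit[OF card_of_Card_order, of Q x] \<open>infinite Q\<close> x
      by (auto simp: Field_card_of)
    have wo: "wo_rel |Q|" by (simp add: wo_rel_def card_of_Well_order)
    have "under |Q| x \<subseteq> underS |Q| y"
    proof
      fix z assume "z \<in> under |Q| x"
      then have z: "(z, x) \<in> |Q|" by (simp add: under_def)
      then have "(z, y) \<in> |Q|" using y(3) wo_rel.TRANS[OF wo] by (meson transD)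
      moreover have "z \<noteq> y" using z y wo_rel.ANTISYM[OF wo] by (meson antisymD)
      ultimately show "z \<in> underS |Q| y" by (simp add: underS_def)
    qed
    then have "|under |Q| x| \<le>o |underS |Q| y|" by (rule card_of_mono1)
    also have "|underS |Q| y| <o |Q|"
      using card_of_underS[OF card_of_Card_order, of y Q] y(1) by (simp add: Field_card_of)
    finally show False using le not_ordLess_ordLeq by blast
  qed
  then obtain g where g: "\<And>x. x \<in> Q \<Longrightarrow> bounds x (g x)" by metis
  have "eventually_along |Q| (\<lambda>a. le b (g a))" if b: "b \<in> J" for b
  proof -
    obtain q where q: "q \<in> Q" "le b q" using Q b unfolding cofinal_def by blast
    show ?thesis
    proof (rule eventually_along_above[of q])
      show "q \<in> Field |Q|" using q by (simp add: Field_card_of)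
      fix a assume a: "a \<in> Field |Q|" "(q, a) \<in> |Q|"
      then have "bounds a (g a)" "q \<in> under |Q| a"
        using g by (auto simp: Field_card_of under_def)
      then have "le q (g a)" "g a \<in> J" unfolding bounds_def by simp_all
      then show "le b (g a)" using trans[OF b _ _ q(2)] q(1) QJ by (meson subsetD)
    qed
  qed
  moreover have "g ` Field |Q| \<subseteq> J" using g by (auto simp: Field_card_of bounds_def)
  ultimately show ?thesis using that cinf card_of_mono1[OF QJ] by blast
qed

text \<open>
  Families of sets carry the topology of pointwise convergence of characteristic functions;
  the next two notions are convergence along \<open>s\<close> and membership in the closure of a
  family, both with respect to that topology.
\<close>

definition tends_pointwise :: "'k rel \<Rightarrow> ('k \<Rightarrow> 'x set) \<Rightarrow> 'x set \<Rightarrow> bool" where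
  "tends_pointwise s f Y \<longleftrightarrow> (\<forall>t. eventually_along s (\<lambda>a. t \<in> f a \<longleftrightarrow> t \<in> Y))"

definition adherent :: "'x set set \<Rightarrow> 'x set \<Rightarrow> bool" where
  "adherent C Y \<longleftrightarrow> (\<forall>H. finite H \<longrightarrow> (\<exists>c\<in>C. c \<inter> H = Y \<inter> H))"

lemma adherentE:
  assumes "adherent C Y" "finite H"
  obtains c where "c \<in> C" "c \<inter> H = Y \<inter> H"
  using assms unfolding adherent_def by (meson that)

lemma adherent_Un: "adherent (C \<union> C') Y \<longleftrightarrow> adherent C Y \<or> adherent C' Y"
proof
  assume *: "adherent (C \<union> C') Y"
  show "adherent C Y \<or> adherent C' Y"
  proof (rule ccontr)
    assume "\<not> (adherent C Y \<or> adherent C' Y)"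
    then have no: "\<not> adherent C Y" "\<not> adherent C' Y" by simp_all
    obtain H where H: "finite H" "\<And>c. c \<in> C \<Longrightarrow> c \<inter> H \<noteq> Y \<inter> H"
      using no(1) unfolding adherent_def by auto
    obtain H' where H': "finite H'" "\<And>c. c \<in> C' \<Longrightarrow> c \<inter> H' \<noteq> Y \<inter> H'"
      using no(2) unfolding adherent_def by auto
    have "finite (H \<union> H')" using H(1) H'(1) by simp
    then obtain c where c: "c \<in> C \<union> C'" "c \<inter> (H \<union> H') = Y \<inter> (H \<union> H')"
      by (rule adherentE[OF *])
    then have "c \<inter> H = Y \<inter> H" "c \<inter> H' = Y \<inter> H'" by blast+
    then show False using c(1) H(2) H'(2) by blast
  qed
qed (auto simp: adherent_def)

text \<open>
  A family of countable sets that is closed under pointwise limits of sequences contains, for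
  every adherent set \<open>Y\<close>, cofinally many of the countable subsets of \<open>Y\<close>. The subset is
  \<open>Y \<inter> L\<close>, where the countable set \<open>L\<close> is closed off under a choice of members
  agreeing with \<open>Y\<close> on finite sets.
\<close>

lemma adherent_countable_subset:
  assumes C: "\<And>f Z. \<lbrakk>range f \<subseteq> C; countable Z; Z \<subseteq> T; tends_pointwise natLeq f Z\<rbrakk> \<Longrightarrow> Z \<in> C"
    and countable: "\<And>c. c \<in> C \<Longrightarrow> countable c"
    and Y: "adherent C Y" "Y \<subseteq> T" and A: "countable A"
  obtains B where "B \<in> C" "A \<inter> Y \<subseteq> B" "B \<subseteq> Y"
proof -
  have "\<forall>H. \<exists>c. finite H \<longrightarrow> c \<in> C \<and> c \<inter> H = Y \<inter> H"
    using Y(1) unfolding adherent_def by blast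
  then obtain c where c: "\<And>H. finite H \<Longrightarrow> c H \<in> C" "\<And>H. finite H \<Longrightarrow> c H \<inter> H = Y \<inter> H"
    by metis
  have "|c H| \<le>o natLeq" if "finite H" for H
    using countable[OF c(1)[OF that]] by (simp add: countable_card_le_natLeq)
  moreover have "|A| \<le>o natLeq" using A by (simp add: countable_card_le_natLeq)
  ultimately obtain L where L: "A \<subseteq> L" "|L| \<le>o natLeq"
    "\<And>H. finite H \<Longrightarrow> H \<subseteq> L \<Longrightarrow> c H \<subseteq> L"
    using closing_off[OF natLeq_Cinfinite, of A c] by metis
  have "countable L" using L(2) by (simp add: countable_card_le_natLeq)
  \<comment> \<open>the sets \<open>D n\<close> are finite and exhaust \<open>L\<close>, so \<open>c (D n)\<close> tends to \<open>Y \<inter> L\<close>\<close>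
  define D where "D n = L \<inter> from_nat_into L ` {..n}" for n :: nat
  have D: "finite (D n)" "D n \<subseteq> L" for n by (auto simp: D_def)
  have "tends_pointwise natLeq (\<lambda>n. c (D n)) (Y \<inter> L)"
    unfolding tends_pointwise_def eventually_along_natLeq
  proof
    fix t
    show "\<forall>\<^sub>F n in sequentially. (t \<in> c (D n)) = (t \<in> Y \<inter> L)"
    proof (cases "t \<in> L")
      case True
      then obtain m where m: "from_nat_into L m = t"
        using from_nat_into_surj[OF \<open>countable L\<close>] by blast
      have "(t \<in> c (D n)) = (t \<in> Y \<inter> L)" if "m \<le> n" for n
      proof -
        have "t \<in> D n" using True m that by (auto simp: D_def)
        then show ?thesis using c(2)[OF D(1), of n] True by blast
      qed
      then show ?thesis unfolding eventually_sequentially by blast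
    next
      case False
      then have "(t \<in> c (D n)) = (t \<in> Y \<inter> L)" for n using L(3)[OF D(1) D(2), of n] by blast
      then show ?thesis by simp
    qed
  qed
  then have "Y \<inter> L \<in> C"
    using C[of "\<lambda>n. c (D n)" "Y \<inter> L"] c(1) D(1) Y(2) \<open>countable L\<close>
    by (simp add: image_subset_iff le_infI1)
  then show ?thesis using that L(1) by blast
qed

section \<open>The paths of a binary tree and the countable sets of its nodes\<close>

text \<open>
  \<open>r\<close> is an initial ordinal that is at most the second uncountable one, and \<open>node \<alpha> b\<close>
  encodes the restriction to the ordinals up to \<open>\<alpha>\<close> of the characteristic function of
  \<open>b\<close>. So the nodes form the full binary tree of height \<open>r\<close>, and \<open>T\<close> is a set that
  contains all of them.
\<close>

locale binary_tree =
  fixes r :: "'i rel" and node :: "'i \<Rightarrow> 'i set \<Rightarrow> 'x" and T :: "'x set"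
  assumes r: "Cinfinite r" and r_le: "r \<le>o aleph_2"
    and node_eq: "\<lbrakk>\<alpha> \<in> Field r; \<beta> \<in> Field r\<rbrakk> \<Longrightarrow>
      node \<alpha> b = node \<beta> b' \<longleftrightarrow> \<alpha> = \<beta> \<and> b \<inter> under r \<alpha> = b' \<inter> under r \<beta>"
    and node_in: "\<alpha> \<in> Field r \<Longrightarrow> node \<alpha> b \<in> T"
begin

text \<open>
  The nodes of the branch \<open>b\<close> whose levels lie in \<open>J\<close>, an initial segment of the
  ordinal.
\<close>

definition path :: "'i set \<Rightarrow> 'i set \<Rightarrow> 'x set" where
  "path b J = (\<lambda>\<alpha>. node \<alpha> b) ` J"

text \<open>The initial segments of branches, where branches themselves are included.\<close>

definition paths :: "'x set set" where
  "paths = {path b J | b J. Order_Relation.ofilter r J}"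

text \<open>The countable sets need not consist of nodes of a single branch.\<close>

definition points :: "'x set set" where
  "points = {Y. Y \<subseteq> T \<and> countable Y} \<union> paths"

lemma wo: "wo_rel r"
  using r by (auto simp: wo_rel_def card_order_on_def)

lemma r_trans: "(\<alpha>, \<beta>) \<in> r \<Longrightarrow> (\<beta>, \<gamma>) \<in> r \<Longrightarrow> (\<alpha>, \<gamma>) \<in> r"
  using wo_rel.TRANS[OF wo] by (meson transD)

lemma r_total: "\<alpha> \<in> Field r \<Longrightarrow> \<beta> \<in> Field r \<Longrightarrow> (\<alpha>, \<beta>) \<in> r \<or> (\<beta>, \<alpha>) \<in> r"
  using wo_rel.TOTALS[OF wo] by blast

lemma r_refl: "\<alpha> \<in> Field r \<Longrightarrow> (\<alpha>, \<alpha>) \<in> r"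
  using r_total by blast

lemma ofilter_Field: "Order_Relation.ofilter r J \<Longrightarrow> J \<subseteq> Field r"
  by (simp add: Order_Relation.ofilter_def)

lemma ofilter_down: "Order_Relation.ofilter r J \<Longrightarrow> \<alpha> \<in> J \<Longrightarrow> (\<beta>, \<alpha>) \<in> r \<Longrightarrow> \<beta> \<in> J"
  by (auto simp: Order_Relation.ofilter_def under_def)

lemma ofilter_cases:
  assumes "Order_Relation.ofilter r J"
  obtains "J = Field r" | \<delta> where "\<delta> \<in> Field r" "J = underS r \<delta>"
  using assms wo_rel.ofilter_underS_Field[OF wo] by blast

lemma ofilter_underS: "Order_Relation.ofilter r (underS r \<delta>)"
  using wo_rel.underS_ofilter[OF wo] .

lemma path_mem_iff:
  assumes "Order_Relation.ofilter r J" "\<alpha> \<in> Field r"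
  shows "node \<alpha> b' \<in> path b J \<longleftrightarrow> \<alpha> \<in> J \<and> b' \<inter> under r \<alpha> = b \<inter> under r \<alpha>"
proof
  assume "node \<alpha> b' \<in> path b J"
  then obtain \<beta> where "\<beta> \<in> J" "node \<alpha> b' = node \<beta> b" by (auto simp: path_def)
  then show "\<alpha> \<in> J \<and> b' \<inter> under r \<alpha> = b \<inter> under r \<alpha>"
    using node_eq[of \<alpha> \<beta> b' b] assms ofilter_Field by blast
next
  assume "\<alpha> \<in> J \<and> b' \<inter> under r \<alpha> = b \<inter> under r \<alpha>"
  then show "node \<alpha> b' \<in> path b J"
    using node_eq[of \<alpha> \<alpha> b' b] assms(2) by (auto simp: path_def)
qed

lemma path_cases:
  assumes "c \<in> paths"
  obtains b J where "c = path b J" "Order_Relation.ofilter r J"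
  using assms by (auto simp: paths_def)

lemma path_subset: "Order_Relation.ofilter r J \<Longrightarrow> path b J \<subseteq> T"
  using node_in ofilter_Field by (auto simp: path_def)

lemma points_subset: "Y \<in> points \<Longrightarrow> Y \<subseteq> T"
  using path_subset by (auto simp: points_def paths_def)

lemma path_down:
  assumes "c \<in> paths" "\<alpha> \<in> Field r" "node \<alpha> b \<in> c" "(\<beta>, \<alpha>) \<in> r"
  shows "node \<beta> b \<in> c"
proof -
  obtain b' J where c: "c = path b' J" and J: "Order_Relation.ofilter r J"
    using path_cases[OF assms(1)] by metis
  have \<beta>: "\<beta> \<in> Field r" using assms(4) by (auto simp: Field_def)
  have \<alpha>: "\<alpha> \<in> J" "b \<inter> under r \<alpha> = b' \<inter> under r \<alpha>"
    using path_mem_iff[OF J assms(2)] assms(3) c by auto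
  have "under r \<beta> \<subseteq> under r \<alpha>" using r_trans assms(4) by (auto simp: under_def)
  then have "b \<inter> under r \<beta> = b' \<inter> under r \<beta>" using \<alpha>(2) by blast
  then show ?thesis using path_mem_iff[OF J \<beta>] ofilter_down[OF J \<alpha>(1) assms(4)] c by blast
qed

lemma path_same_level:
  assumes "c \<in> paths" "\<alpha> \<in> Field r" "node \<alpha> b \<in> c" "node \<alpha> b' \<in> c"
  shows "b \<inter> under r \<alpha> = b' \<inter> under r \<alpha>"
  using assms path_mem_iff by (metis path_cases)

lemma inj_on_node: "inj_on (\<lambda>\<alpha>. node \<alpha> b) (Field r)"
  using node_eq by (auto simp: inj_on_def)

lemma inj_on_full_path: "inj_on (\<lambda>b. path b (Field r)) (Pow (Field r))"
proof (rule inj_onI)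
  fix b b' assume b: "b \<in> Pow (Field r)" "b' \<in> Pow (Field r)"
    and eq: "path b (Field r) = path b' (Field r)"
  have F: "Order_Relation.ofilter r (Field r)" using wo_rel.Field_ofilter[OF wo] .
  have "\<alpha> \<in> b \<longleftrightarrow> \<alpha> \<in> b'" if \<alpha>: "\<alpha> \<in> Field r" for \<alpha>
  proof -
    have "b \<inter> under r \<alpha> = b' \<inter> under r \<alpha>"
      using path_mem_iff[OF F \<alpha>, of b b] path_mem_iff[OF F \<alpha>, of b b'] eq \<alpha> by simp
    moreover have "\<alpha> \<in> under r \<alpha>" using r_refl[OF \<alpha>] by (simp add: under_def)
    ultimately show ?thesis by blast
  qed
  then show "b = b'" using b by blast
qed

lemma card_of_underS_le: "|underS r \<delta>| \<le>o cardSuc natLeq"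
proof (cases "\<delta> \<in> Field r")
  case True
  have "|underS r \<delta>| <o r" using card_of_underS[of r \<delta>] r True by blast
  then have "|underS r \<delta>| <o aleph_2" using r_le ordLess_ordLeq_trans by blast
  then show ?thesis
    using cardSuc_ordLeq_ordLess[OF cardSuc_Card_order[OF natLeq_Card_order] card_of_Card_order]
    by blast
next
  case False
  then have "underS r \<delta> = {}" by (auto simp: underS_def Field_def)
  then show ?thesis
    using card_of_empty1[of "cardSuc natLeq"] cardSuc_Card_order[OF natLeq_Card_order]
    by (auto simp: card_order_on_def)
qed

text \<open>The set of paths is closed in the pointwise topology.\<close>

lemma adherent_paths:
  assumes P: "P \<subseteq> paths" and Y: "adherent P Y"
  shows "Y \<in> paths"
proof -
  have pair: "\<exists>c\<in>P. \<forall>t\<in>H. t \<in> c \<longleftrightarrow> t \<in> Y" if "finite H" for H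
  proof -
    obtain c where "c \<in> P" "c \<inter> H = Y \<inter> H" by (rule adherentE[OF Y \<open>finite H\<close>])
    then show ?thesis by (intro bexI[of _ c]) auto
  qed
  define J where "J = {\<alpha> \<in> Field r. \<exists>b'. node \<alpha> b' \<in> Y}"
  define b where "b = {\<alpha> \<in> Field r. \<exists>b'. node \<alpha> b' \<in> Y \<and> \<alpha> \<in> b'}"
  have down: "node \<beta> b' \<in> Y" if "\<alpha> \<in> Field r" "node \<alpha> b' \<in> Y" "(\<beta>, \<alpha>) \<in> r" for \<alpha> \<beta> b'
  proof -
    obtain c where "c \<in> P" "\<forall>t\<in>{node \<alpha> b', node \<beta> b'}. t \<in> c \<longleftrightarrow> t \<in> Y"
      using pair[of "{node \<alpha> b', node \<beta> b'}"] by auto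
    then show ?thesis using path_down[of c \<alpha> b' \<beta>] P that by blast
  qed
  have J: "Order_Relation.ofilter r J"
    unfolding Order_Relation.ofilter_def
  proof (intro conjI ballI subsetI)
    fix \<alpha> \<beta> assume "\<alpha> \<in> J" "\<beta> \<in> under r \<alpha>"
    then obtain b' where "\<alpha> \<in> Field r" "node \<alpha> b' \<in> Y" "(\<beta>, \<alpha>) \<in> r"
      by (auto simp: J_def under_def)
    then show "\<beta> \<in> J" using down FieldI1 unfolding J_def by fast
  qed (simp add: J_def)
  have level: "b' \<inter> under r \<alpha> = b \<inter> under r \<alpha>" if \<alpha>: "\<alpha> \<in> Field r" "node \<alpha> b' \<in> Y" for \<alpha> b'
  proof (intro set_eqI iffI)
    fix \<gamma> assume \<gamma>: "\<gamma> \<in> b' \<inter> under r \<alpha>"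
    then have "(\<gamma>, \<alpha>) \<in> r" by (simp add: under_def)
    then have "node \<gamma> b' \<in> Y" "\<gamma> \<in> Field r" using down[OF \<alpha>] FieldI1 by fast+
    then show "\<gamma> \<in> b \<inter> under r \<alpha>" using \<gamma> by (auto simp: b_def)
  next
    fix \<gamma> assume \<gamma>: "\<gamma> \<in> b \<inter> under r \<alpha>"
    then obtain b'' where b'': "\<gamma> \<in> Field r" "node \<gamma> b'' \<in> Y" "\<gamma> \<in> b''" by (auto simp: b_def)
    have "(\<gamma>, \<alpha>) \<in> r" using \<gamma> by (simp add: under_def)
    then have "node \<gamma> b' \<in> Y" using down[OF \<alpha>] by blast
    then obtain c where "c \<in> P" "\<forall>t\<in>{node \<gamma> b', node \<gamma> b''}. t \<in> c \<longleftrightarrow> t \<in> Y"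
      using pair[of "{node \<gamma> b', node \<gamma> b''}"] by auto
    then have "b' \<inter> under r \<gamma> = b'' \<inter> under r \<gamma>"
      using path_same_level[of c \<gamma> b' b''] P b''(1,2) \<open>node \<gamma> b' \<in> Y\<close> by blast
    then show "\<gamma> \<in> b' \<inter> under r \<alpha>" using \<gamma> b''(3) r_refl[OF b''(1)] by (auto simp: under_def)
  qed
  have "Y = path b J"
  proof (intro set_eqI iffI)
    fix t assume t: "t \<in> Y"
    obtain c where "c \<in> P" "\<forall>t'\<in>{t}. t' \<in> c \<longleftrightarrow> t' \<in> Y" using pair[of "{t}"] by auto
    then have "c \<in> paths" "t \<in> c" using P t by auto
    then obtain \<alpha> b' where \<alpha>: "\<alpha> \<in> Field r" "t = node \<alpha> b'"
      using ofilter_Field by (auto simp: paths_def path_def)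
    then have "\<alpha> \<in> J" using t by (auto simp: J_def)
    then show "t \<in> path b J" using path_mem_iff[OF J \<alpha>(1)] level[of \<alpha> b'] \<alpha> t by simp
  next
    fix t assume "t \<in> path b J"
    then obtain \<alpha> where \<alpha>: "\<alpha> \<in> J" "t = node \<alpha> b" by (auto simp: path_def)
    then obtain b' where b': "\<alpha> \<in> Field r" "node \<alpha> b' \<in> Y" by (auto simp: J_def)
    then show "t \<in> Y" using level[OF b'] node_eq[of \<alpha> \<alpha> b b'] \<alpha>(2) by simp
  qed
  then show ?thesis using J by (auto simp: paths_def)
qed

end

text \<open>
  A set of points that is closed under limits of sequences indexed by infinite cardinals. The
  cardinals that are needed are \<open>natLeq\<close> and cardinals on the type of the levels.
\<close>

locale limit_closed = binary_tree r node T for r :: "'i rel" and node :: "'i \<Rightarrow> 'i set \<Rightarrow> 'x" and T +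
  fixes C :: "'x set set"
  assumes C_points: "C \<subseteq> points"
    and nat_limit: "\<And>f Y. \<lbrakk>range f \<subseteq> C; Y \<in> points; tends_pointwise natLeq f Y\<rbrakk> \<Longrightarrow> Y \<in> C"
    and limit: "\<And>(s :: 'i rel) f Y. \<lbrakk>Cinfinite s; s \<le>o r; f ` Field s \<subseteq> C; Y \<in> points;
      tends_pointwise s f Y\<rbrakk> \<Longrightarrow> Y \<in> C"
begin

abbreviation countable_members :: "'x set set" where
  "countable_members \<equiv> {c \<in> C. countable c}"

lemma countable_part:
  assumes "adherent countable_members Y" "Y \<subseteq> T" "countable A"
  obtains B where "B \<in> C" "countable B" "A \<inter> Y \<subseteq> B" "B \<subseteq> Y"
proof -
  have nat: "Z \<in> countable_members"
    if "range f \<subseteq> countable_members" "countable Z" "Z \<subseteq> T" "tends_pointwise natLeq f Z" for f Z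
    using nat_limit[of f Z] that by (auto simp: points_def)
  have countable: "countable c" if "c \<in> countable_members" for c using that by simp
  obtain B where B: "B \<in> countable_members" "A \<inter> Y \<subseteq> B" "B \<subseteq> Y"
    by (rule adherent_countable_subset[OF nat countable assms])
  show ?thesis by (rule that[of B]) (use B in auto)
qed

text \<open>
  An uncountable path with at most \<open>\<aleph>\<^sub>1\<close> nodes is exhausted by an
  \<open>\<aleph>\<^sub>1\<close>-sequence of countable sets of nodes, each of which is contained in a
  countable subset of the path that belongs to \<open>C\<close>.
\<close>

lemma short_path_mem:
  assumes J: "Order_Relation.ofilter r J" and le: "|J| \<le>o cardSuc natLeq"
    and adh: "adherent countable_members (path b J)"
  shows "path b J \<in> C"
proof (cases "countable J")
  case True
  then have "countable (path b J)" by (simp add: path_def)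
  then show ?thesis
    using countable_part[OF adh path_subset[OF J], of "path b J"] by (metis inf.idem subset_antisym)
next
  case False
  then have inf: "Cinfinite |J|"
    by (auto simp: cinfinite_def Field_card_of card_of_card_order_on countable_finite)
  have J_le: "|J| \<le>o r"
    using card_of_mono1[OF ofilter_Field[OF J]] card_of_Field_ordIso[of r] r
      ordLeq_ordIso_trans by blast
  have "countable (under |J| x)" if x: "x \<in> J" for x
  proof -
    have "|underS |J| x| <o |J|"
      using card_of_underS[OF card_of_Card_order, of x J] x by (simp add: Field_card_of)
    then have "|underS |J| x| <o cardSuc natLeq" using le ordLess_ordLeq_trans by blast
    then have "|underS |J| x| \<le>o natLeq"
      by (rule iffD1[OF cardSuc_ordLeq_ordLess[OF natLeq_Card_order card_of_Card_order]])
    then have "countable (underS |J| x)" by (simp add: countable_card_le_natLeq)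
    moreover have "under |J| x \<subseteq> insert x (underS |J| x)" by (auto simp: under_def underS_def)
    ultimately show ?thesis by (meson countable_insert countable_subset)
  qed
  \<comment> \<open>\<open>J\<close> is now indexed by the cardinal \<open>|J|\<close>, whose initial parts are countable\<close>
  then have "\<exists>B. B \<in> C \<and> (\<lambda>\<alpha>. node \<alpha> b) ` under |J| x \<inter> path b J \<subseteq> B \<and> B \<subseteq> path b J"
    if "x \<in> J" for x
    using countable_part[OF adh path_subset[OF J], of "(\<lambda>\<alpha>. node \<alpha> b) ` under |J| x"] that
    by (metis countable_image)
  then obtain B where B: "\<And>x. x \<in> J \<Longrightarrow> B x \<in> C" "\<And>x. x \<in> J \<Longrightarrow> B x \<subseteq> path b J"
    "\<And>x. x \<in> J \<Longrightarrow> (\<lambda>\<alpha>. node \<alpha> b) ` under |J| x \<inter> path b J \<subseteq> B x"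
    by metis
  have "tends_pointwise |J| B (path b J)"
    unfolding tends_pointwise_def
  proof
    fix t
    show "eventually_along |J| (\<lambda>a. (t \<in> B a) = (t \<in> path b J))"
    proof (cases "t \<in> path b J")
      case True
      then obtain \<alpha> where \<alpha>: "\<alpha> \<in> J" "t = node \<alpha> b" by (auto simp: path_def)
      show ?thesis
      proof (rule eventually_along_above[of \<alpha>])
        show "\<alpha> \<in> Field |J|" using \<alpha> by (simp add: Field_card_of)
        fix a assume a: "a \<in> Field |J|" "(\<alpha>, a) \<in> |J|"
        then have "t \<in> (\<lambda>\<alpha>. node \<alpha> b) ` under |J| a" using \<alpha> by (auto simp: under_def)
        then show "(t \<in> B a) = (t \<in> path b J)"
          using B(3)[of a] True a(1) by (auto simp: Field_card_of)
      qed
    next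
      case False
      obtain x where "x \<in> J" using \<open>uncountable J\<close> by fastforce
      then show ?thesis
        using B(2) False by (intro eventually_along_above[of x]) (auto simp: Field_card_of)
    qed
  qed
  moreover have "path b J \<in> points" using J by (auto simp: points_def paths_def)
  ultimately show ?thesis using limit[OF inf J_le] B(1) by (auto simp: Field_card_of)
qed

text \<open>
  A full path of length \<open>\<aleph>\<^sub>2\<close> is a limit of the initial segments that belong to
  \<open>C\<close>. These are cofinal: closing off under the choice of countable subsets
  gives initial segments that are adherent to the countable members of \<open>C\<close>.
\<close>

lemma full_path_mem:
  assumes adh: "adherent countable_members (path b (Field r))"
  shows "path b (Field r) \<in> C"
proof (cases "|Field r| \<le>o cardSuc natLeq")
  case True
  then show ?thesis using short_path_mem[OF _ _ adh] wo_rel.Field_ofilter[OF wo] by blast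
next
  case False
  have F: "Order_Relation.ofilter r (Field r)" using wo_rel.Field_ofilter[OF wo] .
  let ?n = "\<lambda>\<alpha>. node \<alpha> b"
  have "\<exists>B. finite H \<longrightarrow> B \<in> C \<and> countable B \<and> ?n ` H \<inter> path b (Field r) \<subseteq> B \<and> B \<subseteq> path b (Field r)"
    for H
    using countable_part[OF adh path_subset[OF F], of "?n ` H"]
    by (metis countable_finite finite_imageI)
  then obtain B where B: "\<And>H. finite H \<Longrightarrow> B H \<in> C" "\<And>H. finite H \<Longrightarrow> countable (B H)"
    "\<And>H. finite H \<Longrightarrow> ?n ` H \<inter> path b (Field r) \<subseteq> B H"
    "\<And>H. finite H \<Longrightarrow> B H \<subseteq> path b (Field r)"
    by metis
  \<comment> \<open>the sets \<open>underS r h\<close> make every closed set of levels an initial segment\<close>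
  define \<phi> where "\<phi> H = {\<alpha> \<in> Field r. ?n \<alpha> \<in> B H} \<union> (\<Union>h\<in>H. underS r h)" for H
  have ci: "Cinfinite (cardSuc natLeq)" using Cinfinite_cardSuc[OF natLeq_Cinfinite] .
  have small: "|S| \<le>o cardSuc natLeq" if "countable S" for S :: "'z set"
    using that cardSuc_ordLeq[OF natLeq_Card_order] ordLeq_transitive
    unfolding countable_card_le_natLeq by blast
  have \<phi>_le: "|\<phi> H| \<le>o cardSuc natLeq" if H: "finite H" for H
  proof -
    have "?n ` {\<alpha> \<in> Field r. ?n \<alpha> \<in> B H} \<subseteq> B H" by blast
    then have "countable (?n ` {\<alpha> \<in> Field r. ?n \<alpha> \<in> B H})"
      using B(2)[OF H] countable_subset by blast
    moreover have "inj_on ?n {\<alpha> \<in> Field r. ?n \<alpha> \<in> B H}"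
      by (rule inj_on_subset[OF inj_on_node]) blast
    ultimately have "countable {\<alpha> \<in> Field r. ?n \<alpha> \<in> B H}" using countable_image_inj_on by blast
    then have "|{\<alpha> \<in> Field r. ?n \<alpha> \<in> B H}| \<le>o cardSuc natLeq" by (rule small)
    moreover have "|\<Union>h\<in>H. underS r h| \<le>o cardSuc natLeq"
      using UNION_Cinfinite_bound[OF small[OF countable_finite[OF H]] _ ci] card_of_underS_le
      by blast
    ultimately show ?thesis unfolding \<phi>_def by (rule Un_Cinfinite_bound[OF _ _ ci])
  qed
  have "\<exists>\<delta>. x \<in> underS r \<delta> \<and> path b (underS r \<delta>) \<in> C" if x: "x \<in> Field r" for x
  proof -
    obtain L0 where L0: "{x} \<subseteq> L0" "|L0| \<le>o cardSuc natLeq"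
      "\<And>H. finite H \<Longrightarrow> H \<subseteq> L0 \<Longrightarrow> \<phi> H \<subseteq> L0"
      using closing_off[OF ci small[OF countable_finite[of "{x}"]], of \<phi>] \<phi>_le
      by (metis finite.emptyI finite_insert)
    define L where "L = L0 \<inter> Field r"
    have closed: "\<phi> H \<subseteq> L" if "finite H" "H \<subseteq> L" for H
    proof -
      have "underS r h \<subseteq> Field r" for h by (auto simp: underS_def Field_def)
      then have "\<phi> H \<subseteq> Field r" unfolding \<phi>_def by blast
      then show ?thesis using L0(3)[of H] that by (auto simp: L_def)
    qed
    have "|L| \<le>o |L0|" by (rule card_of_mono1) (simp add: L_def)
    then have L_le: "|L| \<le>o cardSuc natLeq" using L0(2) ordLeq_transitive by blast
    have L_ofilter: "Order_Relation.ofilter r L"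
      unfolding Order_Relation.ofilter_def
    proof (intro conjI ballI subsetI)
      fix \<alpha> \<beta> assume *: "\<alpha> \<in> L" "\<beta> \<in> under r \<alpha>"
      have "underS r \<alpha> \<subseteq> L" using closed[of "{\<alpha>}"] *(1) by (auto simp: \<phi>_def)
      then show "\<beta> \<in> L" using * by (cases "\<beta> = \<alpha>") (auto simp: under_def underS_def)
    qed (simp add: L_def)
    have "L \<noteq> Field r" using L_le False by metis
    then obtain \<delta> where \<delta>: "L = underS r \<delta>" using ofilter_cases[OF L_ofilter] by metis
    have "adherent countable_members (path b L)"
      unfolding adherent_def
    proof (intro allI impI)
      fix H :: "'x set" assume H: "finite H"
      define H0 where "H0 = {\<alpha> \<in> L. ?n \<alpha> \<in> H}"
      have "?n ` H0 \<subseteq> H" by (auto simp: H0_def)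
      moreover have "inj_on ?n H0"
        by (rule inj_on_subset[OF inj_on_node]) (auto simp: H0_def L_def)
      ultimately have "finite H0" using H inj_on_finite by metis
      then have H0: "finite H0" "H0 \<subseteq> L" by (auto simp: H0_def)
      have "B H0 \<inter> H = path b L \<inter> H"
      proof (intro set_eqI iffI)
        fix t assume t: "t \<in> B H0 \<inter> H"
        then obtain \<alpha> where \<alpha>: "\<alpha> \<in> Field r" "t = ?n \<alpha>"
          using B(4)[OF H0(1)] by (auto simp: path_def)
        then have "\<alpha> \<in> L" using closed[OF H0] t by (auto simp: \<phi>_def)
        then show "t \<in> path b L \<inter> H" using \<alpha> t by (auto simp: path_def)
      next
        fix t assume t: "t \<in> path b L \<inter> H"
        then obtain \<alpha> where \<alpha>: "\<alpha> \<in> L" "t = ?n \<alpha>" by (auto simp: path_def)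
        then have "t \<in> ?n ` H0" "t \<in> path b (Field r)"
          using t by (auto simp: H0_def path_def L_def)
        then show "t \<in> B H0 \<inter> H" using B(3)[OF H0(1)] t by blast
      qed
      then show "\<exists>c\<in>countable_members. c \<inter> H = path b L \<inter> H" using B(1,2)[OF H0(1)] by blast
    qed
    then have "path b L \<in> C" using short_path_mem[OF L_ofilter L_le] by blast
    moreover have "x \<in> L" using L0(1) x by (simp add: L_def)
    ultimately show ?thesis using \<delta> by blast
  qed
  then obtain \<delta> where \<delta>: "\<And>x. x \<in> Field r \<Longrightarrow> x \<in> underS r (\<delta> x)"
    "\<And>x. x \<in> Field r \<Longrightarrow> path b (underS r (\<delta> x)) \<in> C" by metis
  have "tends_pointwise r (\<lambda>x. path b (underS r (\<delta> x))) (path b (Field r))"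
    unfolding tends_pointwise_def
  proof
    fix t
    show "eventually_along r (\<lambda>x. (t \<in> path b (underS r (\<delta> x))) = (t \<in> path b (Field r)))"
    proof (cases "t \<in> path b (Field r)")
      case True
      then obtain \<alpha> where \<alpha>: "\<alpha> \<in> Field r" "t = node \<alpha> b" by (auto simp: path_def)
      show ?thesis
      proof (rule eventually_along_above[OF \<alpha>(1)])
        fix a assume a: "a \<in> Field r" "(\<alpha>, a) \<in> r"
        then have "\<alpha> \<in> underS r (\<delta> a)" using ofilter_down[OF ofilter_underS \<delta>(1)] by blast
        then show "(t \<in> path b (underS r (\<delta> a))) = (t \<in> path b (Field r))"
          using \<alpha> by (auto simp: path_def)
      qed
    next
      case False
      have "path b (underS r (\<delta> x)) \<subseteq> path b (Field r)" for x
        unfolding path_def using ofilter_Field[OF ofilter_underS] by blast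
      then have "(t \<in> path b (underS r (\<delta> x))) = (t \<in> path b (Field r))" for x
        using False by blast
      moreover have "Field r \<noteq> {}" using r by (auto simp: cinfinite_def)
      ultimately show ?thesis unfolding eventually_along_def by blast
    qed
  qed
  moreover have "path b (Field r) \<in> points" using F by (auto simp: points_def paths_def)
  moreover have "r \<le>o r" using r by (auto intro: ordLeq_reflexive simp: card_order_on_def)
  moreover have "(\<lambda>x. path b (underS r (\<delta> x))) ` Field r \<subseteq> C" using \<delta>(2) by blast
  ultimately show ?thesis
    using limit[OF r, of "\<lambda>x. path b (underS r (\<delta> x))" "path b (Field r)"] by simp
qed

text \<open>
  If \<open>Y\<close> is not in \<open>C\<close>, then it is a path and there are paths in \<open>C\<close> that leave it
  at arbitrarily late levels: those that properly extend it do not accumulate at it, because only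
  two nodes can come next. So a cofinal sequence of levels gives a sequence of paths in
  \<open>C\<close> that converges to \<open>Y\<close>.
\<close>

lemma path_limit_mem:
  assumes Y: "adherent {c \<in> C. c \<in> paths} Y"
  shows "Y \<in> C"
proof (rule ccontr)
  assume Y_C: "Y \<notin> C"
  have "Y \<in> paths" using adherent_paths[OF _ Y] by blast
  then obtain b J where Y_eq: "Y = path b J" and J: "Order_Relation.ofilter r J"
    using path_cases by metis
  have split: "\<exists>c\<in>C. c \<in> paths \<and> F \<subseteq> c \<and> \<not> Y \<subseteq> c" if F: "finite F" "F \<subseteq> Y" for F
  proof (rule ofilter_cases[OF J])
    assume J_full: "J = Field r"
    obtain c where "c \<in> {c \<in> C. c \<in> paths}" "c \<inter> F = Y \<inter> F" by (rule adherentE[OF Y F(1)])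
    then have c: "c \<in> C" "c \<in> paths" "c \<inter> F = Y \<inter> F" by simp_all
    have "\<not> Y \<subseteq> c"
    proof
      assume sub: "Y \<subseteq> c"
      obtain b' J' where c_eq: "c = path b' J'" and J': "Order_Relation.ofilter r J'"
        using path_cases[OF c(2)] by metis
      have "c \<subseteq> Y"
      proof
        fix t assume "t \<in> c"
        then obtain \<alpha> where \<alpha>: "\<alpha> \<in> Field r" "t = node \<alpha> b'" "t \<in> c"
          using c_eq ofilter_Field[OF J'] by (auto simp: path_def)
        moreover have "node \<alpha> b \<in> Y" using \<alpha>(1) J_full Y_eq by (auto simp: path_def)
        ultimately show "t \<in> Y"
          using path_same_level[OF c(2) \<alpha>(1), of b b'] node_eq[of \<alpha> \<alpha> b b'] sub by auto
      qed
      then show False using sub c(1) Y_C by auto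
    qed
    then show ?thesis using c F by blast
  next
    fix \<delta> assume \<delta>: "\<delta> \<in> Field r" "J = underS r \<delta>"
    \<comment> \<open>a path that properly extends \<open>Y\<close> contains one of these two nodes at level \<open>\<delta>\<close>\<close>
    define H where "H = insert (node \<delta> (b - {\<delta>})) (insert (node \<delta> (insert \<delta> b)) F)"
    have "finite H" using F(1) by (simp add: H_def)
    then obtain c where "c \<in> {c \<in> C. c \<in> paths}" "c \<inter> H = Y \<inter> H" by (rule adherentE[OF Y])
    then have c: "c \<in> C" "c \<in> paths" "c \<inter> H = Y \<inter> H" by simp_all
    have \<delta>_Y: "node \<delta> b' \<notin> Y" for b'
      using path_mem_iff[OF J \<delta>(1), of b' b] Y_eq \<delta>(2) by (simp add: underS_def)
    have "\<not> Y \<subseteq> c"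
    proof
      assume sub: "Y \<subseteq> c"
      obtain b' J' where c_eq: "c = path b' J'" and J': "Order_Relation.ofilter r J'"
        using path_cases[OF c(2)] by metis
      have agree: "\<alpha> \<in> J' \<and> b \<inter> under r \<alpha> = b' \<inter> under r \<alpha>" if "\<alpha> \<in> J" for \<alpha>
      proof -
        have "\<alpha> \<in> Field r" using that ofilter_Field[OF J] by blast
        moreover have "node \<alpha> b \<in> c" using that sub Y_eq by (auto simp: path_def)
        ultimately show ?thesis using path_mem_iff[OF J'] c_eq by blast
      qed
      have "\<delta> \<in> J'"
      proof (rule ccontr)
        assume "\<delta> \<notin> J'"
        then have "J' \<subseteq> J"
          using ofilter_down[OF J'] ofilter_Field[OF J'] r_total[OF \<delta>(1)]
          unfolding \<delta>(2) underS_def by blast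
        then have "J' = J" using agree by blast
        have same: "node \<alpha> b' = node \<alpha> b" if "\<alpha> \<in> J" for \<alpha>
          using agree[OF that] node_eq[of \<alpha> \<alpha> b' b] that ofilter_Field[OF J] by blast
        have "c \<subseteq> Y" using same by (auto simp: path_def c_eq Y_eq \<open>J' = J\<close>)
        then show False using sub c(1) Y_C by auto
      qed
      then have in_c: "node \<delta> b' \<in> c" using c_eq by (auto simp: path_def)
      have below: "\<gamma> \<in> b \<longleftrightarrow> \<gamma> \<in> b'" if "\<gamma> \<in> J" for \<gamma>
      proof -
        have "\<gamma> \<in> under r \<gamma>" using that ofilter_Field[OF J] r_refl by (auto simp: under_def)
        then show ?thesis using agree[OF that] by blast
      qed
      have "node \<delta> b' = node \<delta> (if \<delta> \<in> b' then insert \<delta> b else b - {\<delta>})"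
      proof -
        have "x \<in> b \<longleftrightarrow> x \<in> b'" if "x \<in> under r \<delta>" "x \<noteq> \<delta>" for x
          using below[of x] that by (simp add: \<delta>(2) under_def underS_def)
        then show ?thesis unfolding node_eq[OF \<delta>(1) \<delta>(1)] by (cases "\<delta> \<in> b'") auto
      qed
      then have "node \<delta> b' \<in> H" by (auto simp: H_def)
      then show False using in_c c(3) \<delta>_Y by blast
    qed
    moreover have "F \<subseteq> c" using c(3) F(2) unfolding H_def by blast
    ultimately show ?thesis using c(1,2) by blast
  qed
  have "J \<noteq> {}" using split[of "{}"] Y_eq by (auto simp: path_def)
  have level: "\<exists>c\<in>C. c \<in> paths \<and> node \<alpha> b \<in> c \<and> \<not> Y \<subseteq> c" if "\<alpha> \<in> J" for \<alpha>
    using split[of "{node \<alpha> b}"] that Y_eq by (auto simp: path_def)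
  have no_max: "\<exists>\<beta>\<in>J. (\<beta>, \<alpha>) \<notin> r" if \<alpha>: "\<alpha> \<in> J" for \<alpha>
  proof (rule ccontr)
    assume no: "\<not> (\<exists>\<beta>\<in>J. (\<beta>, \<alpha>) \<notin> r)"
    obtain c where c: "c \<in> paths" "node \<alpha> b \<in> c" "\<not> Y \<subseteq> c" using level[OF \<alpha>] by blast
    have "\<alpha> \<in> Field r" using \<alpha> ofilter_Field[OF J] by blast
    then have "Y \<subseteq> c" using path_down[OF c(1) _ c(2)] no Y_eq by (auto simp: path_def)
    then show False using c(3) by blast
  qed
  have JF: "J \<subseteq> Field r" using ofilter_Field[OF J] .
  obtain s :: "'i rel" and g where s: "Cinfinite s" "s \<le>o |J|" "g ` Field s \<subseteq> J"
    and g: "\<And>\<beta>. \<beta> \<in> J \<Longrightarrow> eventually_along s (\<lambda>a. (\<beta>, g a) \<in> r)"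
  proof (rule cofinal_cardinal_sequence[of J "\<lambda>x y. (x, y) \<in> r"])
    show "(x, z) \<in> r" if "(x, y) \<in> r" "(y, z) \<in> r" for x y z using r_trans that by blast
    show "(x, y) \<in> r \<or> (y, x) \<in> r" if "x \<in> J" "y \<in> J" for x y using r_total that JF by blast
  qed (use \<open>J \<noteq> {}\<close> no_max in auto)
  from level obtain c where c: "\<And>\<alpha>. \<alpha> \<in> J \<Longrightarrow> c \<alpha> \<in> C" "\<And>\<alpha>. \<alpha> \<in> J \<Longrightarrow> c \<alpha> \<in> paths"
    "\<And>\<alpha>. \<alpha> \<in> J \<Longrightarrow> node \<alpha> b \<in> c \<alpha>" "\<And>\<alpha>. \<alpha> \<in> J \<Longrightarrow> \<not> Y \<subseteq> c \<alpha>"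
    by metis
  have up: "node \<beta> b \<in> c \<alpha>" if "\<alpha> \<in> J" "(\<beta>, \<alpha>) \<in> r" for \<alpha> \<beta>
    using path_down[OF c(2)[OF that(1)] _ c(3)[OF that(1)] that(2)] that(1) JF by blast
  have ne: "Field s \<noteq> {}" using s(1) by (auto simp: cinfinite_def)
  have "tends_pointwise s (\<lambda>a. c (g a)) Y"
    unfolding tends_pointwise_def
  proof
    fix t
    show "eventually_along s (\<lambda>a. (t \<in> c (g a)) = (t \<in> Y))"
    proof (cases "t \<in> Y")
      case True
      then obtain \<beta> where \<beta>: "\<beta> \<in> J" "t = node \<beta> b" using Y_eq by (auto simp: path_def)
      show ?thesis
      proof (rule eventually_along_mono[OF g[OF \<beta>(1)]])
        fix a assume "a \<in> Field s" "(\<beta>, g a) \<in> r"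
        then show "(t \<in> c (g a)) = (t \<in> Y)" using up[of "g a" \<beta>] s(3) \<beta>(2) True by blast
      qed
    next
      case False
      show ?thesis
      proof (cases "\<exists>\<beta> b'. \<beta> \<in> Field r \<and> t = node \<beta> b'")
        case False
        then have "t \<notin> c'" if "c' \<in> paths" for c'
          using that ofilter_Field by (auto simp: paths_def path_def)
        then have "(t \<in> c (g a)) = (t \<in> Y)" if "a \<in> Field s" for a
          using c(2) s(3) that \<open>t \<notin> Y\<close> by blast
        then show ?thesis using ne unfolding eventually_along_def by blast
      next
        case True
        then obtain \<beta> b' where \<beta>: "\<beta> \<in> Field r" "t = node \<beta> b'" by blast
        show ?thesis
        \<comment> \<open>either \<open>t\<close> branches off from \<open>Y\<close> at some level, or it lies above all of \<open>Y\<close>\<close>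
        proof (cases "\<exists>\<gamma>\<in>J. (\<gamma>, \<beta>) \<in> r \<and> node \<gamma> b' \<noteq> node \<gamma> b")
          case True
          then obtain \<gamma> where \<gamma>: "\<gamma> \<in> J" "(\<gamma>, \<beta>) \<in> r" "node \<gamma> b' \<noteq> node \<gamma> b" by blast
          have "\<gamma> \<in> Field r" using \<gamma>(1) JF by blast
          show ?thesis
          proof (rule eventually_along_mono[OF g[OF \<gamma>(1)]])
            fix a assume a: "a \<in> Field s" "(\<gamma>, g a) \<in> r"
            then have ga: "g a \<in> J" using s(3) by blast
            have "t \<notin> c (g a)"
            proof
              assume "t \<in> c (g a)"
              then have "node \<gamma> b' \<in> c (g a)"
                using path_down[OF c(2)[OF ga] \<beta>(1) _ \<gamma>(2)] \<beta>(2) by blast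
              then show False
                using path_same_level[OF c(2)[OF ga] \<open>\<gamma> \<in> Field r\<close>, of b' b] up[OF ga a(2)]
                  node_eq[of \<gamma> \<gamma> b' b] \<gamma>(3) \<open>\<gamma> \<in> Field r\<close> by blast
            qed
            then show "(t \<in> c (g a)) = (t \<in> Y)" using \<open>t \<notin> Y\<close> by blast
          qed
        next
          case same: False
          have "\<beta> \<notin> J"
          proof
            assume "\<beta> \<in> J"
            then have "node \<beta> b' = node \<beta> b" using same r_refl[OF \<beta>(1)] by blast
            then show False using \<open>\<beta> \<in> J\<close> \<open>t \<notin> Y\<close> \<beta>(2) Y_eq by (auto simp: path_def)
          qed
          then have below: "(\<gamma>, \<beta>) \<in> r" if "\<gamma> \<in> J" for \<gamma>
            using ofilter_down[OF J that] r_total[OF \<beta>(1)] JF that by blast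
          have "t \<notin> c (g a)" if a: "a \<in> Field s" for a
          proof
            assume t: "t \<in> c (g a)"
            have ga: "g a \<in> J" using s(3) a by blast
            have "node \<gamma> b \<in> c (g a)" if \<gamma>: "\<gamma> \<in> J" for \<gamma>
              using path_down[OF c(2)[OF ga] \<beta>(1), of b' \<gamma>] t \<beta>(2) below[OF \<gamma>] same \<gamma> by auto
            then have "Y \<subseteq> c (g a)" using Y_eq by (auto simp: path_def)
            then show False using c(4)[OF ga] by blast
          qed
          then show ?thesis using ne \<open>t \<notin> Y\<close> unfolding eventually_along_def by blast
        qed
      qed
    qed
  qed
  moreover have "s \<le>o r"
    using s(2) card_of_mono1[OF JF] card_of_Field_ordIso[of r] r ordLeq_transitive
      ordLeq_ordIso_trans by blast
  moreover have "Y \<in> points" using \<open>Y \<in> paths\<close> by (simp add: points_def)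
  moreover have "(\<lambda>a. c (g a)) ` Field s \<subseteq> C" using c(1) s(3) by blast
  ultimately show False using limit[OF s(1)] Y_C by blast
qed

theorem adherent_imp_mem:
  assumes Y: "Y \<in> points" "adherent C Y"
  shows "Y \<in> C"
proof -
  have eq: "countable_members \<union> {c \<in> C. c \<in> paths} = C"
    using C_points by (auto simp: points_def)
  have "adherent (countable_members \<union> {c \<in> C. c \<in> paths}) Y" unfolding eq by (rule Y(2))
  then have "adherent countable_members Y \<or> adherent {c \<in> C. c \<in> paths} Y"
    unfolding adherent_Un .
  then show ?thesis
  proof
    assume adh: "adherent countable_members Y"
    show ?thesis
    proof (cases "countable Y")
      case True
      obtain B where B: "B \<in> C" "countable B" "Y \<inter> Y \<subseteq> B" "B \<subseteq> Y"
        by (rule countable_part[OF adh points_subset[OF Y(1)] True])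
      then have "B = Y" by blast
      then show ?thesis using B(1) by simp
    next
      case False
      then have "Y \<in> paths" using Y(1) by (simp add: points_def)
      then obtain b J where Y_eq: "Y = path b J" and J: "Order_Relation.ofilter r J"
        using path_cases by metis
      show ?thesis
      proof (rule ofilter_cases[OF J])
        assume "J = Field r"
        then show ?thesis using full_path_mem adh Y_eq by blast
      next
        fix \<delta> assume "J = underS r \<delta>"
        then have "|J| \<le>o cardSuc natLeq" using card_of_underS_le by simp
        then show ?thesis using short_path_mem[OF J] adh Y_eq by simp
      qed
    qed
  qed (rule path_limit_mem)
qed

end

section \<open>A separable extension of the space of points\<close>

text \<open>
  The cardinals that index sequences may live on any type, because a cardinal that is at most
  the cardinality of the space has a copy on the type of the space.
\<close>

lemma radially_closedin_limit:
  fixes X :: "'a topology" and s :: "'k rel"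
  assumes A: "radially_closedin X A" and s: "Cinfinite s" "s \<le>o |topspace X|"
    and f: "f ` Field s \<subseteq> A" "seq_converges s X f x"
  shows "x \<in> A"
proof -
  have wo: "Well_order s" and card: "Card_order s" using s(1) by (auto simp: card_order_on_def)
  have "|Field s| \<le>o |topspace X|"
    using card_of_Field_ordIso[OF card] s(2) ordIso_ordLeq_trans by blast
  then obtain h :: "'k \<Rightarrow> 'a" where h: "inj_on h (Field s)"
    unfolding card_of_ordLeq[symmetric] by blast
  define s' where "s' = dir_image s h"
  have iso: "s =o s'" unfolding s'_def by (rule dir_image_ordIso[OF wo h])
  then have card': "Card_order s'" using Card_order_ordIso2[OF card] by blast
  have field: "Field s' = h ` Field s" unfolding s'_def by (rule dir_image_Field)
  have "infinite (Field s')"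
    using s(1) finite_imageD[OF _ h] unfolding field cinfinite_def by blast
  then have cinf: "Cinfinite s'" using card' by (simp add: cinfinite_def)
  have le: "s' \<le>o |topspace X|" using iso s(2) ordIso_symmetric ordIso_ordLeq_trans by blast
  define k where "k = inv_into (Field s) h"
  have k: "k (h a) = a" if "a \<in> Field s" for a
    using inv_into_f_f[OF h that] by (simp add: k_def)
  have mem: "(h b, h a) \<in> s' \<longleftrightarrow> (b, a) \<in> s" if "a \<in> Field s" "b \<in> Field s" for a b
  proof
    assume "(h b, h a) \<in> s'"
    then obtain b' a' where *: "(b', a') \<in> s" "h b = h b'" "h a = h a'"
      by (auto simp: s'_def dir_image_def)
    then have "b' \<in> Field s" "a' \<in> Field s" by (auto simp: Field_def)
    then show "(b, a) \<in> s" using * h that by (auto simp: inj_on_eq_iff)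
  qed (auto simp: s'_def dir_image_def)
  have "seq_converges s' X (\<lambda>a. f (k a)) x"
    unfolding seq_converges_def
  proof (intro conjI allI impI)
    show "x \<in> topspace X" using f(2) by (simp add: seq_converges_def)
    fix U assume "openin X U \<and> x \<in> U"
    then obtain b where b: "b \<in> Field s" "\<forall>a\<in>Field s. (b, a) \<in> s \<and> a \<noteq> b \<longrightarrow> f a \<in> U"
      using f(2) unfolding seq_converges_def by blast
    have "f (k a) \<in> U" if a: "a \<in> Field s'" "(h b, a) \<in> s'" "a \<noteq> h b" for a
    proof -
      obtain a' where "a' \<in> Field s" "a = h a'" using a(1) field by blast
      then show ?thesis using b mem[of a' b] a k by auto
    qed
    then show "\<exists>b\<in>Field s'. \<forall>a\<in>Field s'. (b, a) \<in> s' \<and> a \<noteq> b \<longrightarrow> f (k a) \<in> U"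
      using b(1) field by (intro bexI[of _ "h b"]) auto
  qed
  moreover have "(\<lambda>a. f (k a)) ` Field s' \<subseteq> A" using f(1) k unfolding field by auto
  ultimately show ?thesis using A cinf le unfolding radially_closedin_def by blast
qed

lemma zero_dimensional_imp_regular_space:
  assumes "zero_dimensional_space X"
  shows "regular_space X"
  unfolding regular_space_def
proof (intro allI impI)
  fix C a assume *: "closedin X C \<and> a \<in> topspace X - C"
  then have "openin X (topspace X - C)" by blast
  then obtain V where V: "openin X V" "closedin X V" "a \<in> V" "V \<subseteq> topspace X - C"
    using assms * unfolding zero_dimensional_space_def by metis
  have "C \<subseteq> topspace X - V" using V(4) * closedin_subset by blast
  then show "\<exists>U V. openin X U \<and> openin X V \<and> a \<in> U \<and> C \<subseteq> V \<and> disjnt U V"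
    using V by (intro exI[of _ V] exI[of _ "topspace X - V"]) (auto simp: disjnt_def)
qed

text \<open>
  The sets of natural numbers that contain 0 form a Cantor set and serve as nodes. A finite set
  \<open>F\<close> of them is the pointwise limit of its clopen neighbourhoods in that Cantor set. The
  extra element, which is not a node, makes the neighbourhoods for different \<open>n\<close>
  different and keeps them apart from the points.
\<close>

definition cantor :: "nat set set" where
  "cantor = {A. 0 \<in> A}"

definition approx :: "nat set set \<Rightarrow> nat \<Rightarrow> nat set set" where
  "approx F n = {A \<in> cantor. \<exists>t\<in>F. A \<inter> {..n} = t \<inter> {..n}} \<union> {{Suc n}}"

definition approxs :: "nat set set set" where
  "approxs = {approx F n | F n. finite F \<and> F \<subseteq> cantor}"

lemma Suc_notin_cantor: "{Suc n} \<notin> cantor"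
  by (simp add: cantor_def)

lemma approx_inject: "approx F n = approx G m \<Longrightarrow> n = m"
proof -
  assume "approx F n = approx G m"
  moreover have "{Suc n} \<in> approx F n" by (simp add: approx_def)
  ultimately have "{Suc n} \<in> approx G m" by simp
  then show "n = m" using Suc_notin_cantor by (simp add: approx_def)
qed

lemma approx_not_subset: "\<not> approx F n \<subseteq> cantor"
  using Suc_notin_cantor by (auto simp: approx_def)

lemma countable_approxs: "countable approxs"
proof -
  define g where "g n S = {A \<in> cantor. A \<inter> {..n} \<in> S} \<union> {{Suc n}}" for n :: nat and S
  have "approx F n = g n ((\<lambda>t. t \<inter> {..n}) ` F)" for F n
    by (auto simp: approx_def g_def image_iff)
  moreover have "(\<lambda>t. t \<inter> {..n}) ` F \<in> Pow (Pow {..n})" for F :: "nat set set" and n by auto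
  ultimately have "approxs \<subseteq> (\<Union>n. g n ` Pow (Pow {..n}))" unfolding approxs_def by blast
  moreover have "countable (\<Union>n. g n ` Pow (Pow {..n}))"
    by (rule countable_UN) (auto intro: countable_finite)
  ultimately show ?thesis by (rule countable_subset)
qed

lemma approx_tends:
  assumes F: "finite F" "F \<subseteq> cantor"
  shows "\<forall>\<^sub>F n in sequentially. t \<in> approx F n \<longleftrightarrow> t \<in> F"
proof (cases "t \<in> F")
  case True
  then show ?thesis using F(2) by (auto simp: approx_def intro!: always_eventually)
next
  case False
  have "\<forall>\<^sub>F n in sequentially. t \<inter> {..n} \<noteq> t' \<inter> {..n}" if t': "t' \<in> F" for t'
  proof -
    have "t \<noteq> t'" using t' False by blast
    then obtain m where m: "m \<in> t \<longleftrightarrow> m \<notin> t'" by blast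
    have "t \<inter> {..n} \<noteq> t' \<inter> {..n}" if "m \<le> n" for n
    proof
      assume "t \<inter> {..n} = t' \<inter> {..n}"
      then have "m \<in> t \<inter> {..n} \<longleftrightarrow> m \<in> t' \<inter> {..n}" by simp
      then show False using m that by simp
    qed
    then show ?thesis unfolding eventually_sequentially by blast
  qed
  then have 1: "\<forall>\<^sub>F n in sequentially. \<forall>t'\<in>F. t \<inter> {..n} \<noteq> t' \<inter> {..n}"
    by (intro eventually_ball_finite F(1)) blast
  have 2: "\<forall>\<^sub>F n in sequentially. t \<noteq> {Suc n}"
  proof (cases "\<exists>m. t = {Suc m}")
    case True
    then obtain m where "t = {Suc m}" by blast
    then have "\<forall>n\<ge>Suc m. t \<noteq> {Suc n}" by auto
    then show ?thesis unfolding eventually_sequentially by blast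
  qed auto
  show ?thesis using 1 2 by eventually_elim (use False in \<open>auto simp: approx_def\<close>)
qed

lemma approx_agrees:
  assumes F: "finite F" "F \<subseteq> cantor" and H: "finite H"
  shows "\<forall>\<^sub>F n in sequentially. approx F n \<inter> H = F \<inter> H"
proof -
  have "\<forall>\<^sub>F n in sequentially. \<forall>t\<in>H. t \<in> approx F n \<longleftrightarrow> t \<in> F"
    by (intro eventually_ball_finite H ballI approx_tends F)
  then show ?thesis by eventually_elim auto
qed

text \<open>
  A set is small if it contains only finitely many terms of each of the approximating
  sequences.
\<close>

definition small :: "nat set set set \<Rightarrow> bool" where
  "small W \<longleftrightarrow> (\<forall>F. finite F \<and> F \<subseteq> cantor \<longrightarrow> (\<forall>\<^sub>F n in sequentially. approx F n \<notin> W))"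

lemma small_mono: "small W \<Longrightarrow> W' \<subseteq> W \<Longrightarrow> small W'"
  unfolding small_def by (auto elim!: eventually_mono)

lemma small_Un: "small W \<Longrightarrow> small W' \<Longrightarrow> small (W \<union> W')"
  unfolding small_def by (auto intro: eventually_conj)

lemma small_empty: "small {}"
  by (simp add: small_def)

lemma small_approx: "small {approx F n}"
  unfolding small_def
proof (intro allI impI)
  fix G
  have "approx G m \<notin> {approx F n}" if "Suc n \<le> m" for m
    using approx_inject[of G m F n] that by auto
  then show "\<forall>\<^sub>F m in sequentially. approx G m \<notin> {approx F n}"
    unfolding eventually_sequentially by blast
qed

text \<open>
  The space consists of the isolated elements of \<open>approxs\<close> and of the points of the
  tree. A basic neighbourhood of a point \<open>Y\<close> is determined by a finite set \<open>H\<close> and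
  a small set \<open>W\<close>: it consists of the elements that agree with \<open>Y\<close> on \<open>H\<close> and
  are not in \<open>W\<close>. So the topology on the points is the pointwise one, the approximating
  sequences converge, and small sets of isolated elements are closed.
\<close>

locale tree_space = binary_tree r node cantor for r :: "'i rel" and node
begin

definition agree :: "nat set set \<Rightarrow> nat set set \<Rightarrow> nat set set set" where
  "agree Y H = {x. x \<inter> H = Y \<inter> H}"

definition is_open :: "nat set set set \<Rightarrow> bool" where
  "is_open U \<longleftrightarrow> U \<subseteq> approxs \<union> points \<and>
    (\<forall>Y\<in>U \<inter> points. \<exists>H. finite H \<and> points \<inter> agree Y H \<subseteq> U \<and> small (approxs \<inter> agree Y H - U))"

definition X :: "nat set set topology" where
  "X = topology is_open"

lemma points_cantor: "Y \<in> points \<Longrightarrow> Y \<subseteq> cantor"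
  by (rule points_subset)

lemma approxs_points_disjoint: "x \<in> approxs \<Longrightarrow> x \<notin> points"
  using approx_not_subset points_cantor by (auto simp: approxs_def)

lemma finite_in_points: "finite F \<Longrightarrow> F \<subseteq> cantor \<Longrightarrow> F \<in> points"
  by (simp add: points_def countable_finite)

lemma approx_in_approxs: "finite F \<Longrightarrow> F \<subseteq> cantor \<Longrightarrow> approx F n \<in> approxs"
  by (auto simp: approxs_def)

lemma is_openI:
  assumes "U \<subseteq> approxs \<union> points"
    and "\<And>Y. \<lbrakk>Y \<in> U; Y \<in> points\<rbrakk> \<Longrightarrow>
      \<exists>H. finite H \<and> points \<inter> agree Y H \<subseteq> U \<and> small (approxs \<inter> agree Y H - U)"
  shows "is_open U"
  using assms by (simp add: is_open_def)

lemma is_openE: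
  assumes "is_open U" "Y \<in> U" "Y \<in> points"
  obtains H where "finite H" "points \<inter> agree Y H \<subseteq> U" "small (approxs \<inter> agree Y H - U)"
  using assms unfolding is_open_def by blast

lemma istopology_is_open: "istopology is_open"
  unfolding istopology_def
proof (intro conjI allI impI)
  fix U V assume U: "is_open U" and V: "is_open V"
  show "is_open (U \<inter> V)"
  proof (rule is_openI)
    show "U \<inter> V \<subseteq> approxs \<union> points" using U by (auto simp: is_open_def)
    fix Y assume Y: "Y \<in> U \<inter> V" "Y \<in> points"
    obtain H where H: "finite H" "points \<inter> agree Y H \<subseteq> U" "small (approxs \<inter> agree Y H - U)"
      using is_openE[OF U, of Y] Y by blast
    obtain H' where H': "finite H'" "points \<inter> agree Y H' \<subseteq> V" "small (approxs \<inter> agree Y H' - V)"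
      using is_openE[OF V, of Y] Y by blast
    have sub: "agree Y (H \<union> H') \<subseteq> agree Y H \<inter> agree Y H'" unfolding agree_def by blast
    have "small ((approxs \<inter> agree Y H - U) \<union> (approxs \<inter> agree Y H' - V))"
      using H(3) H'(3) by (rule small_Un)
    then have "small (approxs \<inter> agree Y (H \<union> H') - U \<inter> V)"
      by (rule small_mono) (use sub in blast)
    then show "\<exists>H. finite H \<and> points \<inter> agree Y H \<subseteq> U \<inter> V \<and> small (approxs \<inter> agree Y H - U \<inter> V)"
      using H(1,2) H'(1,2) sub by (intro exI[of _ "H \<union> H'"]) auto
  qed
next
  fix \<U> assume \<U>: "\<forall>U\<in>\<U>. is_open U"
  show "is_open (\<Union>\<U>)"
  proof (rule is_openI)
    show "\<Union>\<U> \<subseteq> approxs \<union> points" using \<U> by (auto simp: is_open_def)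
    fix Y assume "Y \<in> \<Union>\<U>" "Y \<in> points"
    then obtain U where U: "U \<in> \<U>" "Y \<in> U" by blast
    obtain H where H: "finite H" "points \<inter> agree Y H \<subseteq> U" "small (approxs \<inter> agree Y H - U)"
      using is_openE[of U Y] U \<U> \<open>Y \<in> points\<close> by blast
    have "small (approxs \<inter> agree Y H - \<Union>\<U>)" using H(3) by (rule small_mono) (use U(1) in blast)
    then show "\<exists>H. finite H \<and> points \<inter> agree Y H \<subseteq> \<Union>\<U> \<and> small (approxs \<inter> agree Y H - \<Union>\<U>)"
      using H(1,2) U(1) by blast
  qed
qed

lemma openin_X: "openin X U \<longleftrightarrow> is_open U"
  by (simp add: X_def topology_inverse'[OF istopology_is_open])

lemma topspace_X: "topspace X = approxs \<union> points"
proof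
  show "topspace X \<subseteq> approxs \<union> points"
    using openin_topspace[of X] unfolding openin_X by (simp add: is_open_def)
  have "is_open (approxs \<union> points)"
  proof (rule is_openI)
    fix Y
    have "small (approxs \<inter> agree Y {} - (approxs \<union> points))"
      by (rule small_mono[OF small_empty]) blast
    then show "\<exists>H. finite H \<and> points \<inter> agree Y H \<subseteq> approxs \<union> points \<and>
      small (approxs \<inter> agree Y H - (approxs \<union> points))"
      by (intro exI[of _ "{}"]) blast
  qed simp
  then show "approxs \<union> points \<subseteq> topspace X"
    using openin_subset unfolding openin_X[symmetric] by blast
qed

lemma clopen_basic:
  fixes Y :: "nat set set"
  assumes H: "finite H" and W: "W \<subseteq> approxs" "small W"
  defines "V \<equiv> (approxs \<union> points) \<inter> agree Y H - W"
  shows "openin X V" "closedin X V"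
proof -
  show "openin X V"
    unfolding openin_X
  proof (rule is_openI)
    show "V \<subseteq> approxs \<union> points" by (auto simp: V_def)
    fix Z assume Z: "Z \<in> V" "Z \<in> points"
    have eq: "agree Z H = agree Y H" using Z(1) by (auto simp: V_def agree_def)
    have "points \<inter> agree Z H \<subseteq> V" using W(1) approxs_points_disjoint unfolding eq V_def by blast
    moreover have "small (approxs \<inter> agree Z H - V)"
      by (rule small_mono[OF W(2)]) (auto simp: eq V_def)
    ultimately show "\<exists>H. finite H \<and> points \<inter> agree Z H \<subseteq> V \<and> small (approxs \<inter> agree Z H - V)"
      using H by blast
  qed
  have "is_open (topspace X - V)"
  proof (rule is_openI)
    show "topspace X - V \<subseteq> approxs \<union> points" by (auto simp: topspace_X)
    fix Z assume Z: "Z \<in> topspace X - V" "Z \<in> points"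
    then have "Z \<notin> agree Y H" using W(1) approxs_points_disjoint by (auto simp: V_def)
    then have "agree Z H \<inter> V = {}" by (auto simp: V_def agree_def)
    then have "points \<inter> agree Z H \<subseteq> topspace X - V" "approxs \<inter> agree Z H - (topspace X - V) \<subseteq> {}"
      unfolding topspace_X by blast+
    then show "\<exists>H. finite H \<and> points \<inter> agree Z H \<subseteq> topspace X - V \<and>
        small (approxs \<inter> agree Z H - (topspace X - V))"
      using H small_mono[OF small_empty] by (intro exI[of _ H] conjI)
  qed
  then show "closedin X V" unfolding closedin_def openin_X topspace_X by (auto simp: V_def)
qed

lemma clopen_approx:
  assumes x: "x \<in> approxs"
  shows "openin X {x}" "closedin X {x}"
proof -
  have no_points: "Y \<noteq> x" if "Y \<in> points" for Y using that x approxs_points_disjoint by blast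
  have small_x: "small {x}" using x small_approx by (auto simp: approxs_def)
  show "openin X {x}" unfolding openin_X by (rule is_openI) (use x no_points in auto)
  have "is_open (topspace X - {x})"
  proof (rule is_openI)
    fix Y
    have "small (approxs \<inter> agree Y {} - (topspace X - {x}))"
      by (rule small_mono[OF small_x]) (auto simp: topspace_X)
    moreover have "points \<inter> agree Y {} \<subseteq> topspace X - {x}"
      using no_points by (auto simp: topspace_X)
    ultimately show "\<exists>H. finite H \<and> points \<inter> agree Y H \<subseteq> topspace X - {x} \<and>
      small (approxs \<inter> agree Y H - (topspace X - {x}))"
      by (intro exI[of _ "{}"]) simp
  qed (auto simp: topspace_X)
  then show "closedin X {x}" using x unfolding closedin_def openin_X topspace_X by simp
qed

lemma zero_dimensional_X: "zero_dimensional_space X"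
  unfolding zero_dimensional_space_def
proof (intro exI conjI ballI allI impI)
  let ?B = "{V. openin X V \<and> closedin X V}"
  show "openin X V" "closedin X V" if "V \<in> ?B" for V using that by auto
  fix U x assume U: "openin X U \<and> x \<in> U"
  then have "x \<in> approxs \<union> points" using openin_subset topspace_X by blast
  then show "\<exists>V\<in>?B. x \<in> V \<and> V \<subseteq> U"
  proof
    assume "x \<in> approxs"
    then show ?thesis using clopen_approx U by (intro bexI[of _ "{x}"]) auto
  next
    assume x: "x \<in> points"
    obtain H where H: "finite H" "points \<inter> agree x H \<subseteq> U" "small (approxs \<inter> agree x H - U)"
      using is_openE[of U x] U x unfolding openin_X by blast
    let ?V = "(approxs \<union> points) \<inter> agree x H - (approxs \<inter> agree x H - U)"
    have "?V \<in> ?B" using clopen_basic[OF H(1) _ H(3), of x] by blast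
    moreover have "x \<in> ?V" "?V \<subseteq> U" using x U H(2) by (auto simp: agree_def)
    ultimately show ?thesis by (intro bexI[of _ ?V] conjI)
  qed
qed

lemma Hausdorff_X: "Hausdorff_space X"
proof (rule regular_t1_imp_Hausdorff_space)
  show "regular_space X" by (rule zero_dimensional_imp_regular_space[OF zero_dimensional_X])
  show "t1_space X"
    unfolding t1_space_def
  proof (intro ballI impI)
    fix x y assume x: "x \<in> topspace X" and y: "y \<in> topspace X" and ne: "x \<noteq> y"
    consider "x \<in> approxs" | "y \<in> approxs" | "x \<in> points" "y \<in> points"
      using x y unfolding topspace_X by blast
    then show "\<exists>U. openin X U \<and> x \<in> U \<and> y \<notin> U"
    proof cases
      case 1
      then show ?thesis using clopen_approx(1) ne by blast
    next
      case 2
      then have "openin X (topspace X - {y})" using clopen_approx(2) by blast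
      then show ?thesis using x ne by blast
    next
      case 3
      obtain t where t: "t \<in> x \<longleftrightarrow> t \<notin> y" using ne by blast
      have "openin X ((approxs \<union> points) \<inter> agree x {t} - {})"
        by (rule clopen_basic(1)) (simp_all add: small_empty)
      moreover have "y \<notin> agree x {t}" using t by (auto simp: agree_def)
      ultimately show ?thesis using 3 by (intro exI[of _ "(approxs \<union> points) \<inter> agree x {t} - {}"]) (auto simp: agree_def)
    qed
  qed
qed

lemma approx_eventually_in:
  assumes U: "openin X U" and Y: "Y \<in> U" "Y \<in> points"
  obtains H where "finite H" "\<And>F. \<lbrakk>finite F; F \<subseteq> cantor; F \<in> agree Y H\<rbrakk> \<Longrightarrow>
    \<forall>\<^sub>F n in sequentially. approx F n \<in> U"
proof -
  obtain H where H: "finite H" "small (approxs \<inter> agree Y H - U)"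
    using is_openE[of U Y] U Y unfolding openin_X by blast
  have "\<forall>\<^sub>F n in sequentially. approx F n \<in> U" if F: "finite F" "F \<subseteq> cantor" "F \<in> agree Y H" for F
  proof -
    have "\<forall>\<^sub>F n in sequentially. approx F n \<notin> approxs \<inter> agree Y H - U"
      using H(2) F(1,2) unfolding small_def by blast
    then show ?thesis using approx_agrees[OF F(1,2) H(1)]
      by eventually_elim (use F approx_in_approxs in \<open>auto simp: agree_def\<close>)
  qed
  then show ?thesis using that H(1) by blast
qed

text \<open>The isolated elements are dense because the finite points are.\<close>

lemma separable_X: "separable_space X"
  unfolding separable_space_def
proof (intro exI conjI)
  show "countable approxs" by (rule countable_approxs)
  show "approxs \<subseteq> topspace X" by (simp add: topspace_X)
  have "\<exists>y\<in>approxs. y \<in> U" if x: "x \<in> topspace X" and U: "x \<in> U" "openin X U" for x U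
  proof (cases "x \<in> approxs")
    case False
    then have xp: "x \<in> points" using x by (simp add: topspace_X)
    obtain H where H: "finite H" "\<And>F. \<lbrakk>finite F; F \<subseteq> cantor; F \<in> agree x H\<rbrakk> \<Longrightarrow>
      \<forall>\<^sub>F n in sequentially. approx F n \<in> U"
      using approx_eventually_in[OF U(2,1) xp] by metis
    have F: "finite (x \<inter> H)" "x \<inter> H \<subseteq> cantor" "x \<inter> H \<in> agree x H"
      using H(1) points_cantor[OF xp] by (auto simp: agree_def)
    obtain n where "approx (x \<inter> H) n \<in> U"
      using eventually_happens[OF H(2)[OF F]] by auto
    then show ?thesis using approx_in_approxs[OF F(1,2)] by blast
  qed (use U in blast)
  then show "X closure_of approxs = topspace X" unfolding closure_of_def by auto
qed

lemma pointwise_imp_converges: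
  assumes s: "Cinfinite s" and f: "f ` Field s \<subseteq> points" and Y: "Y \<in> points"
    and lim: "tends_pointwise s f Y"
  shows "seq_converges s X f Y"
  unfolding seq_converges_def
proof (intro conjI allI impI)
  show "Y \<in> topspace X" using Y by (simp add: topspace_X)
  fix U assume U: "openin X U \<and> Y \<in> U"
  obtain H where H: "finite H" "points \<inter> agree Y H \<subseteq> U"
    using is_openE[of U Y] U Y unfolding openin_X by blast
  have wo: "Well_order s" "Field s \<noteq> {}" using s by (auto simp: card_order_on_def cinfinite_def)
  have "eventually_along s (\<lambda>a. \<forall>t\<in>H. t \<in> f a \<longleftrightarrow> t \<in> Y)"
    using lim by (intro eventually_along_ball[OF wo H(1)]) (simp add: tends_pointwise_def)
  then have "eventually_along s (\<lambda>a. f a \<in> U)"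
  proof (rule eventually_along_mono)
    fix a assume "a \<in> Field s" "\<forall>t\<in>H. t \<in> f a \<longleftrightarrow> t \<in> Y"
    then have "f a \<in> points \<inter> agree Y H" using f by (auto simp: agree_def)
    then show "f a \<in> U" using H(2) by blast
  qed
  then show "\<exists>b\<in>Field s. \<forall>a\<in>Field s. (b, a) \<in> s \<and> a \<noteq> b \<longrightarrow> f a \<in> U"
    unfolding eventually_along_def .
qed

lemma card_of_topspace: "|Pow (Field r)| \<le>o |topspace X|"
proof -
  have "(\<lambda>b. path b (Field r)) ` Pow (Field r) \<subseteq> topspace X"
    using wo_rel.Field_ofilter[OF wo] by (auto simp: topspace_X points_def paths_def)
  then show ?thesis using inj_on_full_path card_of_ordLeq by blast
qed

lemma r_le_topspace: "r \<le>o |topspace X|"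
proof -
  have "r <o |Pow (Field r)|" using r by (intro Card_order_Pow) blast
  then show ?thesis using card_of_topspace ordLess_ordLeq_trans ordLess_imp_ordLeq by blast
qed

text \<open>
  Near a point outside a radially closed set \<open>C\<close> there are no points of \<open>C\<close>, and
  the isolated elements of \<open>C\<close> there form a small set, as a subsequence of an
  approximating sequence would have its limit in \<open>C\<close>.
\<close>

lemma pseudoradial_X: "pseudoradial_space X"
  unfolding pseudoradial_space_def
proof (intro allI impI)
  fix C assume C: "radially_closedin X C"
  have C_sub: "C \<subseteq> approxs \<union> points" using C by (simp add: radially_closedin_def topspace_X)
  have nat_le: "natLeq \<le>o |topspace X|"
    using natLeq_ordLeq_cinfinite[OF r] r_le_topspace ordLeq_transitive by blast
  interpret limit_closed r node cantor "C \<inter> points"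
  proof
    show "C \<inter> points \<subseteq> points" by simp
    show "Y \<in> C \<inter> points"
      if "range f \<subseteq> C \<inter> points" "Y \<in> points" "tends_pointwise natLeq f Y" for f Y
    proof -
      have "seq_converges natLeq X f Y"
        using that by (intro pointwise_imp_converges[OF natLeq_Cinfinite]) (auto simp: Field_natLeq)
      then show ?thesis
        using radially_closedin_limit[OF C natLeq_Cinfinite nat_le, of f Y] that
        by (auto simp: Field_natLeq)
    qed
    show "Y \<in> C \<inter> points"
      if s: "Cinfinite s" "s \<le>o r" and f: "f ` Field s \<subseteq> C \<inter> points" "Y \<in> points"
        "tends_pointwise s f Y" for s :: "'i rel" and f Y
    proof -
      have "seq_converges s X f Y"
        using f by (intro pointwise_imp_converges[OF s(1)]) auto
      moreover have "s \<le>o |topspace X|" using s(2) r_le_topspace ordLeq_transitive by blast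
      ultimately show ?thesis using radially_closedin_limit[OF C s(1), of f Y] f by auto
    qed
  qed
  have "is_open (topspace X - C)"
  proof (rule is_openI)
    show "topspace X - C \<subseteq> approxs \<union> points" by (auto simp: topspace_X)
    fix Y assume Y: "Y \<in> topspace X - C" "Y \<in> points"
    then have "\<not> adherent (C \<inter> points) Y" using adherent_imp_mem by blast
    then obtain H where H: "finite H" "\<And>c. c \<in> C \<inter> points \<Longrightarrow> c \<inter> H \<noteq> Y \<inter> H"
      unfolding adherent_def by auto
    have disj: "C \<inter> points \<inter> agree Y H = {}" using H(2) by (auto simp: agree_def)
    have "small (approxs \<inter> agree Y H \<inter> C)"
      unfolding small_def
    proof (intro allI impI, rule ccontr)
      fix F assume F: "finite F \<and> F \<subseteq> cantor"
        and *: "\<not> (\<forall>\<^sub>F n in sequentially. approx F n \<notin> approxs \<inter> agree Y H \<inter> C)"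
      define N where "N = {n. approx F n \<in> approxs \<inter> agree Y H \<inter> C}"
      have "infinite N"
      proof
        assume "finite N"
        then obtain m where "\<forall>n\<in>N. n < m" using finite_nat_set_iff_bounded by blast
        then have "\<forall>n\<ge>m. approx F n \<notin> approxs \<inter> agree Y H \<inter> C" unfolding N_def by force
        then show False using * unfolding eventually_sequentially by blast
      qed
      define f where "f k = approx F (enumerate N k)" for k
      have in_N: "enumerate N k \<in> N" for k using enumerate_in_set[OF \<open>infinite N\<close>] .
      have F_points: "F \<in> points" using F finite_in_points by blast
      have "seq_converges natLeq X f F"
        unfolding seq_converges_def
      proof (intro conjI allI impI)
        show "F \<in> topspace X" using F_points by (simp add: topspace_X)
        fix U assume U: "openin X U \<and> F \<in> U"
        have "\<forall>\<^sub>F n in sequentially. approx F n \<in> U"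
          using approx_eventually_in[of U F] U F_points F by (auto simp: agree_def)
        then have "\<forall>\<^sub>F k in sequentially. f k \<in> U"
          unfolding f_def by (rule eventually_subseq[OF strict_mono_enumerate[OF \<open>infinite N\<close>]])
        then show "\<exists>b\<in>Field natLeq. \<forall>a\<in>Field natLeq. (b, a) \<in> natLeq \<and> a \<noteq> b \<longrightarrow> f a \<in> U"
          unfolding eventually_along_natLeq[symmetric] eventually_along_def .
      qed
      moreover have "f ` Field natLeq \<subseteq> C" using in_N by (auto simp: f_def N_def)
      ultimately have "F \<in> C"
        using radially_closedin_limit[OF C natLeq_Cinfinite nat_le] by blast
      obtain m where m: "\<And>n. m \<le> n \<Longrightarrow> approx F n \<inter> H = F \<inter> H"
        using approx_agrees[of F H] F H(1) unfolding eventually_sequentially by blast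
      obtain n where n: "m \<le> n" "n \<in> N" using \<open>infinite N\<close> infinite_nat_iff_unbounded_le by blast
      then have "F \<in> agree Y H" using m[of n] by (auto simp: N_def agree_def)
      then show False using disj \<open>F \<in> C\<close> F_points by blast
    qed
    moreover have "approxs \<inter> agree Y H - (topspace X - C) = approxs \<inter> agree Y H \<inter> C"
      by (auto simp: topspace_X)
    moreover have "points \<inter> agree Y H \<subseteq> topspace X - C" using disj by (auto simp: topspace_X)
    ultimately show "\<exists>H. finite H \<and> points \<inter> agree Y H \<subseteq> topspace X - C \<and>
        small (approxs \<inter> agree Y H - (topspace X - C))"
      using H(1) by auto
  qed
  then show "closedin X C" using C_sub unfolding closedin_def openin_X topspace_X by simp
qed

end

section \<open>The choice of the height of the tree\<close>

lemma card_of_Pow_mono: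
  assumes "|A| \<le>o |B|"
  shows "|Pow A| \<le>o |Pow B|"
proof -
  obtain f where f: "inj_on f A" "f ` A \<subseteq> B" using assms unfolding card_of_ordLeq[symmetric] by blast
  have "inj_on (image f) (Pow A)" "image f ` Pow A \<subseteq> Pow B"
    using f by (auto intro: inj_on_image_Pow)
  then show ?thesis unfolding card_of_ordLeq[symmetric] by blast
qed

text \<open>
  The nodes can be coded by sets of natural numbers as soon as the height of the tree and the
  size of each level are at most the continuum.
\<close>

lemma tree_spaceI:
  fixes r :: "'i rel"
  assumes r: "Cinfinite r" "r \<le>o aleph_2" "r \<le>o |UNIV :: nat set set|"
    and Pow: "\<And>\<delta>. \<delta> \<in> Field r \<Longrightarrow> |Pow (underS r \<delta>)| \<le>o |UNIV :: nat set set|"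
  obtains node where "tree_space r node"
proof -
  have "|Pow (under r \<delta>)| \<le>o |UNIV :: nat set set|" if \<delta>: "\<delta> \<in> Field r" for \<delta>
  proof -
    have wo: "wo_rel r" using r(1) by (auto simp: wo_rel_def card_order_on_def)
    obtain \<epsilon> where \<epsilon>: "\<epsilon> \<in> Field r" "\<delta> \<noteq> \<epsilon>" "(\<delta>, \<epsilon>) \<in> r"
      using infinite_Card_order_limit[of r \<delta>] r(1) \<delta> by (auto simp: cinfinite_def)
    have "under r \<delta> \<subseteq> underS r \<epsilon>"
    proof
      fix z assume "z \<in> under r \<delta>"
      then have z: "(z, \<delta>) \<in> r" by (simp add: under_def)
      then have "(z, \<epsilon>) \<in> r" using \<epsilon>(3) wo_rel.TRANS[OF wo] by (meson transD)
      moreover have "z \<noteq> \<epsilon>" using z \<epsilon> wo_rel.ANTISYM[OF wo] by (meson antisymD)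
      ultimately show "z \<in> underS r \<epsilon>" by (simp add: underS_def)
    qed
    then have "|Pow (under r \<delta>)| \<le>o |Pow (underS r \<epsilon>)|" by (intro card_of_mono1 Pow_mono)
    then show ?thesis using Pow[OF \<epsilon>(1)] ordLeq_transitive by blast
  qed
  moreover have "|Field r| \<le>o |UNIV :: nat set set|"
    using card_of_Field_ordIso[of r] r(1,3) ordIso_ordLeq_trans by blast
  moreover have "infinite (UNIV :: nat set set)" by (simp add: Finite_Set.finite_set)
  ultimately have "|SIGMA \<alpha>:Field r. Pow (under r \<alpha>)| \<le>o |UNIV :: nat set set|"
    by (intro card_of_Sigma_ordLeq_infinite) auto
  then obtain e :: "'i \<times> 'i set \<Rightarrow> nat set"
    where e: "inj_on e (SIGMA \<alpha>:Field r. Pow (under r \<alpha>))"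
    unfolding card_of_ordLeq[symmetric] by blast
  define node where "node \<alpha> b = insert 0 (Suc ` e (\<alpha>, b \<inter> under r \<alpha>))" for \<alpha> b
  have inj: "insert 0 (Suc ` A) = insert 0 (Suc ` B) \<longleftrightarrow> A = B" for A B :: "nat set"
  proof
    assume eq: "insert 0 (Suc ` A) = insert 0 (Suc ` B)"
    have "n \<in> A \<longleftrightarrow> n \<in> B" for n
    proof -
      have "n \<in> A \<longleftrightarrow> Suc n \<in> insert 0 (Suc ` A)" by auto
      also have "\<dots> \<longleftrightarrow> n \<in> B" unfolding eq by auto
      finally show ?thesis .
    qed
    then show "A = B" by blast
  qed simp
  have "tree_space r node"
  proof (unfold_locales; (rule r(1) r(2))?)
    show "node \<alpha> b = node \<beta> b' \<longleftrightarrow> \<alpha> = \<beta> \<and> b \<inter> under r \<alpha> = b' \<inter> under r \<beta>"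
      if "\<alpha> \<in> Field r" "\<beta> \<in> Field r" for \<alpha> \<beta> b b'
      unfolding node_def inj using inj_on_eq_iff[OF e] that by auto
    show "node \<alpha> b \<in> cantor" for \<alpha> b by (simp add: node_def cantor_def)
  qed
  then show ?thesis by (rule that)
qed

(* A separable regular Hausdorff space has at most 2^(2^aleph_0) points, which is the number of
   elements of the type nat set set, so every such space has a copy on a subset of this type. *)
theorem theorem4p3:
  assumes "continuum \<le>o aleph_2"
  shows "\<exists>X :: nat set set topology.
           regular_space X \<and> Hausdorff_space X \<and> separable_space X \<and>
           zero_dimensional_space X \<and> pseudoradial_space X \<and>
           continuum <o |topspace X|"
proof -
  let ?c = "|UNIV :: nat set set|" and ?\<omega>1 = "cardSuc natLeq"
  have c: "continuum =o ?c"
    unfolding cexp_def ctwo_def Field_natLeq Field_card_of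
    using card_of_Pow_Func[of "UNIV :: nat set"] ordIso_symmetric by (simp add: Pow_UNIV)
  have \<omega>1: "Cinfinite ?\<omega>1" by (rule Cinfinite_cardSuc[OF natLeq_Cinfinite])
  have \<omega>1_le: "?\<omega>1 \<le>o ?c"
    using cardSuc_least[OF natLeq_Card_order card_of_Card_order, of "UNIV :: nat set set"]
      Card_order_Pow[OF natLeq_Card_order] by (simp add: Field_natLeq Pow_UNIV)
  have main: ?thesis if node: "tree_space r node" and large: "continuum <o |Pow (Field r)|"
    for r :: "'i rel" and node
  proof -
    interpret tree_space r node by (rule node)
    have "continuum <o |topspace X|" using large card_of_topspace ordLess_ordLeq_trans by blast
    then show ?thesis
      using zero_dimensional_X zero_dimensional_imp_regular_space Hausdorff_X separable_X
        pseudoradial_X by blast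
  qed
  show ?thesis
  proof (cases "|Pow (Field ?\<omega>1)| \<le>o ?c")
    \<comment> \<open>the height is the second uncountable cardinal\<close>
    case True
    let ?r = "cardSuc ?\<omega>1"
    have co: "Card_order ?\<omega>1" using \<omega>1 by blast
    have r: "Cinfinite ?r" by (rule Cinfinite_cardSuc[OF \<omega>1])
    have "?\<omega>1 <o ?c" using Card_order_Pow[OF co] True ordLess_ordLeq_trans by blast
    then have r_le: "?r \<le>o ?c" by (rule cardSuc_least[OF co card_of_Card_order])
    have "|Pow (underS ?r \<delta>)| \<le>o ?c" if "\<delta> \<in> Field ?r" for \<delta>
    proof -
      have "|underS ?r \<delta>| <o ?r" using card_of_underS[of ?r \<delta>] r that by blast
      then have "|underS ?r \<delta>| \<le>o ?\<omega>1"
        using cardSuc_ordLeq_ordLess[OF co card_of_Card_order] by blast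
      then have "|underS ?r \<delta>| \<le>o |Field ?\<omega>1|"
        using card_of_Field_ordIso[OF co] ordIso_symmetric ordLeq_ordIso_trans by blast
      then show ?thesis using card_of_Pow_mono True ordLeq_transitive by blast
    qed
    moreover have "?r \<le>o aleph_2" using r by (auto intro: ordLeq_reflexive simp: card_order_on_def)
    ultimately obtain node where "tree_space ?r node" using tree_spaceI[OF r _ r_le] by blast
    moreover have "continuum <o |Pow (Field ?r)|"
      using assms Card_order_Pow[of ?r] r ordLeq_ordLess_trans by blast
    ultimately show ?thesis by (rule main)
  next
    \<comment> \<open>the height is the first uncountable cardinal\<close>
    case False
    have "?c <o |Pow (Field ?\<omega>1)|"
      using False not_ordLeq_iff_ordLess[OF card_of_Well_order card_of_Well_order] by blast
    then have large: "continuum <o |Pow (Field ?\<omega>1)|" using c ordIso_ordLess_trans by blast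
    have "|Pow (underS ?\<omega>1 \<delta>)| \<le>o ?c" if "\<delta> \<in> Field ?\<omega>1" for \<delta>
    proof -
      have "|underS ?\<omega>1 \<delta>| <o ?\<omega>1" using card_of_underS[of ?\<omega>1 \<delta>] \<omega>1 that by blast
      then have "|underS ?\<omega>1 \<delta>| \<le>o natLeq"
        using cardSuc_ordLeq_ordLess[OF natLeq_Card_order card_of_Card_order] by blast
      then have "|underS ?\<omega>1 \<delta>| \<le>o |UNIV :: nat set|"
        using card_of_nat ordIso_symmetric ordLeq_ordIso_trans by blast
      then show ?thesis using card_of_Pow_mono by (metis Pow_UNIV)
    qed
    moreover have "?\<omega>1 \<le>o aleph_2" using \<omega>1 by (intro cardSuc_ordLeq) blast
    ultimately obtain node where "tree_space ?\<omega>1 node" using tree_spaceI[OF \<omega>1 _ \<omega>1_le] by blast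
    then show ?thesis using large by (rule main)
  qed
qed

end
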